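(* Let $\mathcal{E}_\infty$ (with kernels $\mathcal{L}_N^\infty$) be a Feller boundary of a system $(\mathcal{E}_N,\mathcal{L}_N^{N+1})_{N=1}^\infty$. For all $N\in\mathbb{N}$, let $(\mathsf{P}_N(t))_{t\ge0}$ be Feller semigroups on $\mathcal{E}_N$ satisfying $$\mathsf{P}_{N+1}(t)\mathcal{L}_N^{N+1}=\mathcal{L}_N^{N+1}\mathsf{P}_N(t),\quad\forall t\ge0,\ \forall N\in\mathbb{N},$$ and let $(\mathsf{P}_\infty(t))_{t\ge0}$ be the unique Feller semigroup on $\mathcal{E}_\infty$ such that $\mathsf{P}_\infty(t)\mathcal{L}_N^\infty=\mathcal{L}_N^\infty\mathsf{P}_N(t)$ for all $t\ge0$, $N\in\mathbb{N}$. Suppose $(\mu_N)_{N=1}^\infty$ is a consistent sequence of probability measures with corresponding boundary measure $\mu_\infty\in\mathscr{M}_{\mathrm p}(\mathcal{E}_\infty)$ uniquely determined by $\mu_\infty\mathcal{L}_N^\infty=\mu_N$ for all $N\in\mathbb{N}$. Moreover, suppose that for all consistent sequences of probability measures $(\nu_N)_{N=1}^\infty$ we have $$\nu_N\mathsf{P}_N(t)(f)\longrightarrow\mu_N(f)\ \text{ as } t\to\infty,\quad\forall f\in C_b(\mathcal{E}_N),\ \forall N\in\mathbb{N}.$$ Then, for any $\nu_\infty\in\mathscr{M}_{\mathrm p}(\mathcal{E}_\infty)$, we have $$\nu_\infty\mathsf{P}_\infty(t)(f)\longrightarrow\mu_\infty(f)\ \text{ as } t\to\infty,\quad\forall f\in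 C_b(\mathcal{E}_\infty).$$ In particular, $\mu_\infty$ is the unique invariant measure of $(\mathsf{P}_\infty(t))_{t\ge0}$.
   Context: For a Polish space $\mathscr{X}$, $\mathscr{M}_{\mathrm p}(\mathscr{X})$ is the set of Borel probability measures with the weak topology; $C_b(\mathscr{X})$ is the space of bounded continuous real functions; for locally compact $\mathscr{X}$, $C_0(\mathscr{X})$ is the Banach space (sup norm) of continuous functions vanishing at infinity. A Markov kernel $\mathscr{K}:\mathscr{X}_1\to\mathscr{X}_2$ acts on measures from $\mathscr{M}_{\mathrm p}(\mathscr{X}_1)$ to $\mathscr{M}_{\mathrm p}(\mathscr{X}_2)$ and on bounded Borel functions on $\mathscr{X}_2$, giving functions on $\mathscr{X}_1$; between locally compact Polish spaces it is Feller if it maps $C_0(\mathscr{X}_2)$ to $C_0(\mathscr{X}_1)$. A Feller semigroup on a locally compact Polish space $\mathscr{X}$ is a semigroup $(\mathsf{P}_t)_{t\ge0}$ of positive contraction operators on $C_0(\mathscr{X})$ (given by Markov kernels) with $\mathsf{P}_tC_0(\mathscr{X})\subset C_0(\mathscr{X})$ and $\mathsf{P}_tf(x)\to f(x)$ as $t\to0$ for all $f\in C_0(\mathscr{X})$, $x\in\mathscr{X}$. Data: $(\mathcal{E}_N)_{N=1}^\infty$ is a sequence of locally compact Polish spaces and for each $N$, $\mathcal{L}_N^{N+1}:\mathcal{E}_{N+1}\to\mathcal{E}_N$ is a Feller Markov kernel. A consistent sequence of probability measures is an element of the projective limit $\{(\mu_N)_{N=1}^\infty\in\prod_{N=1}^\infty\mathscr{M}_{\mathrm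 p}(\mathcal{E}_N):\mu_{N+1}\mathcal{L}_N^{N+1}=\mu_N\ \forall N\in\mathbb{N}\}$ (with the projective limit topology). A Feller boundary of the system is a locally compact Polish space $\mathcal{E}_\infty$ with Feller Markov kernels $\mathcal{L}_N^\infty:\mathcal{E}_\infty\to\mathcal{E}_N$ satisfying $\mathcal{L}_{N+1}^\infty\mathcal{L}_N^{N+1}=\mathcal{L}_N^\infty$ for all $N$, such that the map $\mathfrak{m}\mapsto(\mathfrak{m}\mathcal{L}_N^\infty)_{N=1}^\infty$ from $\mathscr{M}_{\mathrm p}(\mathcal{E}_\infty)$ to the projective limit is a Borel isomorphism. Existence and uniqueness of $(\mathsf{P}_\infty(t))_{t\ge0}$ is a known result (the method of intertwiners of Borodin and Olshanski). *)

theory Defs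
  imports "HOL-Probability.Probability"
begin

text \<open>
  Spaces are abstract topologies rather than types of a topological class, because the data contain
  a whole sequence of different spaces. The sequence \<open>E :: nat \<Rightarrow> 'a topology\<close> puts all of them on one
  type, which is no restriction: a countable family of spaces always lives on a disjoint union.
  Sequences indexed by $N = 1, 2, \dots$ are indexed here by \<^typ>\<open>nat\<close> starting from \<open>0\<close>.
  Functions and kernels on a space \<open>X\<close> matter only through their values on \<^term>\<open>topspace X\<close>.
\<close>

definition lc_polish_space :: "'a topology \<Rightarrow> bool" where
  "lc_polish_space X \<longleftrightarrow>
     completely_metrizable_space X \<and> separable_space X \<and> locally_compact_space X"

definition borel_of :: "'a topology \<Rightarrow> 'a measure" where
  "borel_of X = sigma (topspace X) {U. openin X U}"

lemma space_borel_of [simp]: "space (borel_of X) = topspace X"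
  and sets_borel_of: "sets (borel_of X) = sigma_sets (topspace X) {U. openin X U}"
proof -
  have "{U. openin X U} \<subseteq> Pow (topspace X)"
    using openin_subset by blast
  then show "space (borel_of X) = topspace X"
    and "sets (borel_of X) = sigma_sets (topspace X) {U. openin X U}"
    by (simp_all add: borel_of_def)
qed

definition C_b :: "'a topology \<Rightarrow> ('a \<Rightarrow> real) set" where
  "C_b X = {f. continuous_map X euclideanreal f \<and> bounded (f ` topspace X)}"

definition C_0 :: "'a topology \<Rightarrow> ('a \<Rightarrow> real) set" where
  "C_0 X = {f. continuous_map X euclideanreal f \<and>
     (\<forall>\<epsilon>>0. \<exists>K. compactin X K \<and> (\<forall>x\<in>topspace X - K. \<bar>f x\<bar> < \<epsilon>))}"

definition prob_measures :: "'a topology \<Rightarrow> 'a measure set" where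
  "prob_measures X = {\<mu>. sets \<mu> = sets (borel_of X) \<and> prob_space \<mu>}"

definition weak_topology :: "'a topology \<Rightarrow> 'a measure topology" where
  "weak_topology X = topology_generated_by
     {{\<mu> \<in> prob_measures X. (\<integral>x. f x \<partial>\<mu>) \<in> U} | f U. f \<in> C_b X \<and> open U}"

lemma topspace_weak_topology [simp]: "topspace (weak_topology X) = prob_measures X"
proof -
  have "prob_measures X \<in>
      {{\<mu> \<in> prob_measures X. (\<integral>x. f x \<partial>\<mu>) \<in> U} | f U. f \<in> C_b X \<and> open U}"
    by (intro CollectI exI[of _ "\<lambda>_. 0"] exI[of _ UNIV]) (auto simp: C_b_def bounded_def)
  then show ?thesis
    unfolding weak_topology_def topology_generated_by_topspace by blast
qed

text \<open>
  A kernel \<open>K\<close> from \<open>X\<close> to \<open>Y\<close> acts on measures by \<open>\<mu> \<mapsto> \<mu> \<bind> K\<close>; the composition \<open>K K'\<close> (first \<open>K\<close>,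
  then \<open>K'\<close>) is \<open>\<lambda>x. K x \<bind> K'\<close>. The target \<^const>\<open>prob_algebra\<close> expresses that every \<open>K x\<close> is a
  probability measure and that \<open>x \<mapsto> K x A\<close> is measurable for every Borel set \<open>A\<close>.
\<close>

definition markov_kernel :: "'a topology \<Rightarrow> 'b topology \<Rightarrow> ('a \<Rightarrow> 'b measure) \<Rightarrow> bool" where
  "markov_kernel X Y K \<longleftrightarrow> K \<in> borel_of X \<rightarrow>\<^sub>M prob_algebra (borel_of Y)"

definition kernel_op :: "('a \<Rightarrow> 'b measure) \<Rightarrow> ('b \<Rightarrow> real) \<Rightarrow> 'a \<Rightarrow> real" where
  "kernel_op K f x = (\<integral>y. f y \<partial>K x)"

definition feller_kernel :: "'a topology \<Rightarrow> 'b topology \<Rightarrow> ('a \<Rightarrow> 'b measure) \<Rightarrow> bool" where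
  "feller_kernel X Y K \<longleftrightarrow> markov_kernel X Y K \<and> (\<forall>f\<in>C_0 Y. kernel_op K f \<in> C_0 X)"

text \<open>
  Positivity and contractivity of the operators are not listed because they hold for the operators
  of any Markov kernel.
\<close>

definition feller_semigroup :: "'a topology \<Rightarrow> (real \<Rightarrow> 'a \<Rightarrow> 'a measure) \<Rightarrow> bool" where
  "feller_semigroup X P \<longleftrightarrow>
     (\<forall>t\<ge>0. feller_kernel X X (P t)) \<and>
     (\<forall>f\<in>C_0 X. \<forall>x\<in>topspace X. kernel_op (P 0) f x = f x) \<and>
     (\<forall>s\<ge>0. \<forall>t\<ge>0. \<forall>f\<in>C_0 X. \<forall>x\<in>topspace X.
        kernel_op (P (s + t)) f x = kernel_op (P s) (kernel_op (P t) f) x) \<and>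
     (\<forall>f\<in>C_0 X. \<forall>x\<in>topspace X. ((\<lambda>t. kernel_op (P t) f x) \<longlongrightarrow> f x) (at_right 0))"

definition feller_system ::
    "(nat \<Rightarrow> 'a topology) \<Rightarrow> (nat \<Rightarrow> 'a \<Rightarrow> 'a measure) \<Rightarrow> bool" where
  "feller_system E L \<longleftrightarrow>
     (\<forall>N. lc_polish_space (E N)) \<and> (\<forall>N. feller_kernel (E (Suc N)) (E N) (L N))"

definition consistent_sequences ::
    "(nat \<Rightarrow> 'a topology) \<Rightarrow> (nat \<Rightarrow> 'a \<Rightarrow> 'a measure) \<Rightarrow> (nat \<Rightarrow> 'a measure) set" where
  "consistent_sequences E L =
     {\<mu>. (\<forall>N. \<mu> N \<in> prob_measures (E N)) \<and> (\<forall>N. \<mu> (Suc N) \<bind> L N = \<mu> N)}"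

definition projective_limit ::
    "(nat \<Rightarrow> 'a topology) \<Rightarrow> (nat \<Rightarrow> 'a \<Rightarrow> 'a measure) \<Rightarrow> (nat \<Rightarrow> 'a measure) topology" where
  "projective_limit E L =
     subtopology (product_topology (\<lambda>N. weak_topology (E N)) UNIV) (consistent_sequences E L)"

definition borel_isomorphism :: "'a topology \<Rightarrow> 'b topology \<Rightarrow> ('a \<Rightarrow> 'b) \<Rightarrow> bool" where
  "borel_isomorphism X Y \<phi> \<longleftrightarrow>
     bij_betw \<phi> (topspace X) (topspace Y) \<and>
     \<phi> \<in> borel_of X \<rightarrow>\<^sub>M borel_of Y \<and>
     the_inv_into (topspace X) \<phi> \<in> borel_of Y \<rightarrow>\<^sub>M borel_of X"

definition feller_boundary ::
    "(nat \<Rightarrow> 'a topology) \<Rightarrow> (nat \<Rightarrow> 'a \<Rightarrow> 'a measure) \<Rightarrow>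
     'b topology \<Rightarrow> (nat \<Rightarrow> 'b \<Rightarrow> 'a measure) \<Rightarrow> bool" where
  "feller_boundary E L Einf Linf \<longleftrightarrow>
     lc_polish_space Einf \<and>
     (\<forall>N. feller_kernel Einf (E N) (Linf N)) \<and>
     (\<forall>N. \<forall>x\<in>topspace Einf. Linf (Suc N) x \<bind> L N = Linf N x) \<and>
     borel_isomorphism (weak_topology Einf) (projective_limit E L) (\<lambda>m N. m \<bind> Linf N)"

text \<open>The relation $Q\,\Lambda = \Lambda\,P$ of kernels, for \<open>Q\<close> on \<open>X\<close>, \<open>P\<close> on \<open>Y\<close> and \<open>\<Lambda>\<close> from \<open>X\<close> to \<open>Y\<close>.\<close>

definition intertwined ::
    "'a topology \<Rightarrow> (real \<Rightarrow> 'a \<Rightarrow> 'a measure) \<Rightarrow> ('a \<Rightarrow> 'b measure) \<Rightarrow>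
     (real \<Rightarrow> 'b \<Rightarrow> 'b measure) \<Rightarrow> bool" where
  "intertwined X Q \<Lambda> P \<longleftrightarrow> (\<forall>t\<ge>0. \<forall>x\<in>topspace X. Q t x \<bind> \<Lambda> = \<Lambda> x \<bind> P t)"

definition invariant_measure ::
    "'a topology \<Rightarrow> (real \<Rightarrow> 'a \<Rightarrow> 'a measure) \<Rightarrow> 'a measure \<Rightarrow> bool" where
  "invariant_measure X P \<mu> \<longleftrightarrow> \<mu> \<in> prob_measures X \<and> (\<forall>t\<ge>0. \<mu> \<bind> P t = \<mu>)"

end

theory Submission
  imports Defs
begin

text \<open>
  The family of functions $\Lambda_N g$, with $\Lambda_N$ the kernel from the boundary to the
  $N$-th space and $g \in C_0(\mathcal{E}_N)$, determines a probability measure on the boundary,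
  because \<open>m \<mapsto> (m \<Lambda>\<^sub>N)\<^sub>N\<close> is injective. By the intertwining relations the hypothesis says that
  $\nu_\infty \mathsf{P}_\infty(t)$ converges to $\mu_\infty$ when tested against this family. The
  passage to all bounded continuous functions is a compactness argument
  (\<open>weak_convergence_from_kernel_images\<close>). Any sequence of probability measures on a locally compact
  Polish space has a subsequence converging vaguely to some sub-probability measure $M$
  (\<open>vague_sequential_compactness\<close>). The kernels are Feller, so $\Lambda_N g$ is in $C_0$ and the limit
  satisfies $M\Lambda_N(g) = \mu_\infty\Lambda_N(g)$ for all $g \in C_0(\mathcal{E}_N)$, that is,
  $M\Lambda_N = \mu_\infty\Lambda_N$. In particular $M$ has mass $1$, as Markov kernels preserve mass,
  and $M = \mu_\infty$ by injectivity. As no mass was lost, vague convergence improves to weak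
  convergence (\<open>vague_convergence_imp_weak\<close>).

  Vague compactness is reduced to Helly's selection theorem on the real line, which avoids the Riesz
  representation theorem. A countable base $V_0, V_1, \dots$ of the topology gives a Borel map $c$ from
  the space to $[0,1]$, where the ternary digits of $c(x)$ record which $V_i$ contain $x$. The map $c$ is
  not continuous, but every $f \in C_0$ is of the form $F_f \circ c$ with $F_f$ continuous on the
  closure of the image of $c$ (\<open>C_0_factors_through_base_code\<close>). Hence weak limits $\rho$ of the image
  measures on the line compute the limits of the integrals of all $f \in C_0$. Each point $y$ of the
  closure of the image of $c$ either represents a point $x$ of the space, in the sense that
  $F_f(y) = f(x)$ for all $f$, or the point at infinity, in the sense that $F_f(y) = 0$ for all $f$
  (\<open>decode_dichotomy\<close>). The image of $\rho$, restricted to the former, under this decoding is the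
  vague limit; what $\rho$ carries at infinity is the mass that escapes.

  Invariance of $\mu_\infty$ follows by letting $s \to \infty$ in
  $\mu_\infty\mathsf{P}_\infty(s+t)(f) = \mu_\infty\mathsf{P}_\infty(s)(\mathsf{P}_\infty(t)f)$ for
  $f \in C_0$, and an invariant measure equals its own limit as $t \to \infty$.
\<close>

section \<open>Functions vanishing at infinity on locally compact Polish spaces\<close>

lemma metrizable_separable_imp_second_countable:
  assumes "metrizable_space X" and "separable_space X"
  shows "second_countable X"
proof -
  obtain M d where Md: "Metric_space M d" and X: "X = Metric_space.mtopology M d"
    using assms(1) by (auto simp: metrizable_space_def)
  interpret Metric_space M d by (rule Md)
  obtain C where C: "countable C" "C \<subseteq> M" "mtopology closure_of C = M"
    using assms(2) by (auto simp: separable_space_def X)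
  define B where "B = (\<Union>c\<in>C. range (\<lambda>q :: rat. mball c (of_rat q)))"
  have dense: "\<exists>V\<in>B. x \<in> V \<and> V \<subseteq> U" if U: "openin mtopology U" and x: "x \<in> U" for U x
  proof -
    obtain r where r: "r > 0" "mball x r \<subseteq> U"
      using U x openin_mtopology by blast
    obtain q where q: "0 < real_of_rat q" "real_of_rat q < r / 2"
      using of_rat_dense[of 0 "r / 2"] r(1) by (metis half_gt_zero)
    have xM: "x \<in> M" using U x openin_subset by fastforce
    then have "x \<in> mtopology closure_of C" using C by simp
    then obtain c where c: "c \<in> C" "c \<in> mball x (of_rat q)"
      using q(1) unfolding metric_closure_of by blast
    have "x \<in> mball c (of_rat q)" using c xM by (simp add: commute)
    moreover have "mball c (of_rat q) \<subseteq> mball x r"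
    proof
      fix y assume y: "y \<in> mball c (of_rat q)"
      then have "d x y \<le> d x c + d c y" using c xM by (intro triangle) auto
      also have "\<dots> < r" using y c q by auto
      finally show "y \<in> mball x r" using y xM by simp
    qed
    moreover have "mball c (of_rat q) \<in> B" using c(1) unfolding B_def by blast
    ultimately show ?thesis using r(2) by (meson subset_trans)
  qed
  show ?thesis
    unfolding second_countable_def X
  proof (intro exI conjI)
    show "countable B" unfolding B_def using C(1) by simp
    show "\<forall>V\<in>B. openin mtopology V" by (simp add: B_def)
    show "\<forall>U x. openin mtopology U \<and> x \<in> U \<longrightarrow> (\<exists>V\<in>B. x \<in> V \<and> V \<subseteq> U)"
      using dense by simp
  qed
qed

lemma lc_polish_space_imp_metrizable: "lc_polish_space X \<Longrightarrow> metrizable_space X"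
  by (simp add: lc_polish_space_def completely_metrizable_imp_metrizable_space)

lemma lc_polish_space_imp_second_countable: "lc_polish_space X \<Longrightarrow> second_countable X"
  by (simp add: lc_polish_space_def completely_metrizable_imp_metrizable_space
      metrizable_separable_imp_second_countable)

lemma openin_in_sets_borel_of: "openin X U \<Longrightarrow> U \<in> sets (borel_of X)"
  by (simp add: sets_borel_of sigma_sets.Basic)

lemma continuous_map_borel_measurable:
  assumes "continuous_map X euclideanreal f"
  shows "f \<in> borel_measurable (borel_of X)"
proof (rule borel_measurableI)
  fix S :: "real set" assume "open S"
  then have "openin X {x \<in> topspace X. f x \<in> S}"
    using openin_continuous_map_preimage[OF assms] by auto
  moreover have "f -` S \<inter> space (borel_of X) = {x \<in> topspace X. f x \<in> S}" by auto
  ultimately show "f -` S \<inter> space (borel_of X) \<in> sets (borel_of X)"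
    by (simp add: openin_in_sets_borel_of)
qed

lemma C_0_continuous: "f \<in> C_0 X \<Longrightarrow> continuous_map X euclideanreal f"
  by (simp add: C_0_def)

lemma C_0_small:
  assumes "f \<in> C_0 X" and "e > 0"
  obtains K where "compactin X K" "\<forall>x\<in>topspace X - K. \<bar>f x\<bar> < e"
  using assms unfolding C_0_def by blast

lemma C_0_measurable: "f \<in> C_0 X \<Longrightarrow> f \<in> borel_measurable (borel_of X)"
  by (simp add: C_0_continuous continuous_map_borel_measurable)

lemma C_b_measurable: "f \<in> C_b X \<Longrightarrow> f \<in> borel_measurable (borel_of X)"
  by (simp add: C_b_def continuous_map_borel_measurable)

lemma C_b_bounded:
  assumes "f \<in> C_b X"
  obtains B where "B > 0" "\<And>x. x \<in> topspace X \<Longrightarrow> \<bar>f x\<bar> \<le> B"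
  using assms unfolding C_b_def bounded_pos by auto

lemma C_0_subset_C_b: "C_0 X \<subseteq> C_b X"
proof
  fix f assume f: "f \<in> C_0 X"
  then obtain K where K: "compactin X K" "\<forall>x\<in>topspace X - K. \<bar>f x\<bar> < 1"
    by (rule C_0_small[OF _ zero_less_one])
  have "compactin euclideanreal (f ` K)"
    using f K(1) image_compactin C_0_continuous by blast
  then have "bounded (f ` K)" by (simp add: compact_imp_bounded)
  moreover have "bounded (f ` (topspace X - K))"
    using K(2) by (auto simp: bounded_iff intro!: exI[of _ 1] less_imp_le)
  ultimately have "bounded (f ` K \<union> f ` (topspace X - K))" by simp
  then have "bounded (f ` topspace X)" by (rule bounded_subset) auto
  then show "f \<in> C_b X" using f by (simp add: C_b_def C_0_continuous)
qed

lemma C_0_dominated: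
  assumes f: "f \<in> C_0 X" and g: "continuous_map X euclideanreal g"
    and le: "\<And>x. x \<in> topspace X \<Longrightarrow> \<bar>g x\<bar> \<le> c * \<bar>f x\<bar>"
  shows "g \<in> C_0 X"
  unfolding C_0_def
proof (intro CollectI conjI g allI impI)
  fix e :: real assume e: "e > 0"
  define c' where "c' = max c 1"
  obtain K where K: "compactin X K" "\<forall>x\<in>topspace X - K. \<bar>f x\<bar> < e / c'"
    using C_0_small[OF f, of "e / c'"] e by (auto simp: c'_def)
  have "\<bar>g x\<bar> < e" if "x \<in> topspace X - K" for x
  proof -
    have "\<bar>g x\<bar> \<le> c * \<bar>f x\<bar>" using le that by auto
    also have "\<dots> \<le> c' * \<bar>f x\<bar>" unfolding c'_def by (intro mult_right_mono) auto
    also have "\<dots> < e"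
      using K(2) that by (auto simp: c'_def less_divide_eq mult.commute)
    finally show ?thesis .
  qed
  with K(1) show "\<exists>K. compactin X K \<and> (\<forall>x\<in>topspace X - K. \<bar>g x\<bar> < e)" by blast
qed

lemma C_0_add:
  assumes f: "f \<in> C_0 X" and g: "g \<in> C_0 X"
  shows "(\<lambda>x. f x + g x) \<in> C_0 X"
  unfolding C_0_def
proof (intro CollectI conjI allI impI)
  show "continuous_map X euclideanreal (\<lambda>x. f x + g x)"
    using f g by (intro continuous_map_add C_0_continuous)
  fix e :: real assume e: "e > 0"
  obtain K where K: "compactin X K" "\<forall>x\<in>topspace X - K. \<bar>f x\<bar> < e / 2"
    using C_0_small[OF f half_gt_zero[OF e]] by blast
  obtain K' where K': "compactin X K'" "\<forall>x\<in>topspace X - K'. \<bar>g x\<bar> < e / 2"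
    using C_0_small[OF g half_gt_zero[OF e]] by blast
  have "\<bar>f x + g x\<bar> < e" if "x \<in> topspace X - (K \<union> K')" for x
  proof -
    have "\<bar>f x\<bar> < e / 2" "\<bar>g x\<bar> < e / 2" using K(2) K'(2) that by auto
    then show ?thesis by linarith
  qed
  with K(1) K'(1) show "\<exists>K. compactin X K \<and> (\<forall>x\<in>topspace X - K. \<bar>f x + g x\<bar> < e)"
    by (meson compactin_Un)
qed

lemma C_0_zero: "(\<lambda>_. 0) \<in> C_0 X"
  by (auto simp: C_0_def intro!: exI[of _ "{}"])

lemma C_0_sum: "(\<And>k. k \<in> A \<Longrightarrow> f k \<in> C_0 X) \<Longrightarrow> (\<lambda>x. \<Sum>k\<in>A. f k x) \<in> C_0 X"
proof (induction A rule: infinite_finite_induct)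
  case (insert k A)
  then show ?case using C_0_add[of "f k" X "\<lambda>x. \<Sum>k\<in>A. f k x"] by simp
qed (simp_all add: C_0_zero)

lemma C_0_bump:
  assumes X: "locally_compact_space X" "Hausdorff_space X" and U: "openin X U" "x \<in> U"
  obtains f where "f \<in> C_0 X" "f x = 1" "\<And>y. y \<in> topspace X \<Longrightarrow> 0 \<le> f y"
    "\<And>y. y \<in> topspace X - U \<Longrightarrow> f y = 0"
proof -
  have "neighbourhood_base_of (compactin X) X"
    using X by (simp add: locally_compact_space_neighbourhood_base)
  then obtain W K where WK: "openin X W" "compactin X K" "x \<in> W" "W \<subseteq> K" "K \<subseteq> U"
    using U unfolding neighbourhood_base_of by metis
  have "completely_regular_space X"
    using X locally_compact_regular_imp_completely_regular_space by blast
  moreover have "closedin X (topspace X - W)" "x \<in> topspace X - (topspace X - W)"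
    using WK(1,3) openin_subset by auto
  ultimately obtain g :: "'a \<Rightarrow> real" where g: "continuous_map X (top_of_set {0..1}) g"
      "g x = 0" "g ` (topspace X - W) \<subseteq> {1}"
    unfolding completely_regular_space_def by blast
  have gc: "continuous_map X euclideanreal g" and g01: "\<And>y. y \<in> topspace X \<Longrightarrow> g y \<in> {0..1}"
    using g(1) by (auto simp: continuous_map_in_subtopology)
  show ?thesis
  proof (rule that[of "\<lambda>y. 1 - g y"])
    have "\<exists>K. compactin X K \<and> (\<forall>y\<in>topspace X - K. \<bar>1 - g y\<bar> < e)" if "e > 0" for e
      using WK(2,4) g(3) that by (intro exI[of _ K]) force
    then show "(\<lambda>y. 1 - g y) \<in> C_0 X"
      using gc by (auto simp: C_0_def intro!: continuous_map_diff)
    show "1 - g y = 0" if "y \<in> topspace X - U" for y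
      using that g(3) WK(4,5) by force
  qed (use g g01 in auto)
qed

text \<open>
  Indicators of open sets are pointwise limits of $C_0$ functions. This is what connects $C_0$ with the
  Borel sets, both for uniqueness of measures and for measurability of maps into the space.
\<close>

lemma C_0_exhausts_open:
  assumes X: "lc_polish_space X" and U: "openin X U"
  obtains u :: "nat \<Rightarrow> 'a \<Rightarrow> real" where "\<And>n. u n \<in> C_0 X"
    "\<And>n x. x \<in> topspace X \<Longrightarrow> 0 \<le> u n x" "\<And>n x. x \<in> topspace X \<Longrightarrow> u n x \<le> 1"
    "\<And>x. x \<in> topspace X \<Longrightarrow> (\<lambda>n. u n x) \<longlonglongrightarrow> indicator U x"
    "\<And>n x. x \<in> topspace X - U \<Longrightarrow> u n x = 0"
proof -
  have lc: "locally_compact_space X" and H: "Hausdorff_space X"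
    using X by (auto simp: lc_polish_space_def metrizable_imp_Hausdorff_space
        completely_metrizable_imp_metrizable_space)
  obtain \<B> where \<B>: "countable \<B>" "\<And>V x. openin X V \<Longrightarrow> x \<in> V \<Longrightarrow> \<exists>W\<in>\<B>. x \<in> W \<and> W \<subseteq> V"
    using lc_polish_space_imp_second_countable[OF X] unfolding second_countable_def by metis
  define P where "P f \<longleftrightarrow> f \<in> C_0 X \<and> (\<forall>y\<in>topspace X. 0 \<le> f y) \<and> (\<forall>y\<in>topspace X - U. f y = 0)"
    for f :: "'a \<Rightarrow> real"
  define pos where "pos f W \<longleftrightarrow> P f \<and> (\<forall>y\<in>W. 0 < f y)" for f :: "'a \<Rightarrow> real" and W
  \<comment> \<open>One bump function for each base set that admits one: by second countability, countably many
      functions vanishing off \<open>U\<close> have no common zero in \<open>U\<close>. The zero function keeps \<open>S\<close> nonempty.\<close>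
  define S where "S = insert (\<lambda>_. 0) ((\<lambda>W. SOME f. pos f W) ` {W \<in> \<B>. \<exists>f. pos f W})"
  have SP: "P f" if "f \<in> S" for f
  proof -
    have "P (SOME f. pos f W)" if "\<exists>f. pos f W" for W
      using someI_ex[OF that] by (simp add: pos_def)
    then show ?thesis using that by (auto simp: S_def P_def C_0_zero)
  qed
  have Spos: "\<exists>f\<in>S. f x > 0" if x: "x \<in> U" for x
  proof -
    obtain f where f: "f \<in> C_0 X" "f x = 1" "\<And>y. y \<in> topspace X \<Longrightarrow> 0 \<le> f y"
        "\<And>y. y \<in> topspace X - U \<Longrightarrow> f y = 0"
      using C_0_bump[OF lc H U x] by metis
    have "openin X {y \<in> topspace X. f y \<in> {0<..}}"
      using C_0_continuous[OF f(1)] by (rule openin_continuous_map_preimage) auto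
    moreover have "x \<in> {y \<in> topspace X. f y \<in> {0<..}}"
      using x U f(2) openin_subset by force
    ultimately obtain W where W: "W \<in> \<B>" "x \<in> W" "W \<subseteq> {y \<in> topspace X. f y \<in> {0<..}}"
      using \<B>(2) by blast
    have "pos f W" using f W(3) by (auto simp: pos_def P_def)
    then have "\<exists>f. pos f W" by blast
    from someI_ex[OF this] this W show ?thesis
      by (intro bexI[of _ "SOME f. pos f W"]) (auto simp: S_def pos_def)
  qed
  have Scount: "countable S" "S \<noteq> {}" using \<B>(1) by (auto simp: S_def)
  define e where "e = from_nat_into S"
  have e: "P (e n)" for n using SP Scount(2) by (simp add: e_def from_nat_into)
  define u where "u n x = min 1 (real n * (\<Sum>k<n. e k x))" for n x
  have s0: "0 \<le> real n * (\<Sum>k<n. e k x)" if "x \<in> topspace X" for n x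
    using e that by (auto simp: P_def intro!: mult_nonneg_nonneg sum_nonneg)
  show ?thesis
  proof (rule that[of u])
    fix n
    have *: "(\<lambda>x. \<Sum>k<n. e k x) \<in> C_0 X" using e by (intro C_0_sum) (simp add: P_def)
    show "u n \<in> C_0 X"
    proof (rule C_0_dominated[OF *, where c = "real n"])
      show "continuous_map X euclideanreal (u n)"
        unfolding u_def
        by (intro continuous_map_real_min continuous_map_real_mult_left C_0_continuous[OF *]) auto
      show "\<bar>u n x\<bar> \<le> real n * \<bar>\<Sum>k<n. e k x\<bar>" if "x \<in> topspace X" for x
      proof -
        have "real n * (\<Sum>k<n. e k x) \<le> real n * \<bar>\<Sum>k<n. e k x\<bar>"
          by (intro mult_left_mono) auto
        then show ?thesis using s0[OF that, of n] unfolding u_def by linarith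
      qed
    qed
  next
    fix x assume x: "x \<in> topspace X"
    show "(\<lambda>n. u n x) \<longlonglongrightarrow> indicator U x"
    proof (cases "x \<in> U")
      case True
      obtain k where k: "e k x > 0"
        using Spos[OF True] Scount from_nat_into_surj unfolding e_def by metis
      obtain m :: nat where m: "1 < real m * e k x" using k ex_less_of_nat_mult by blast
      have "u n x = 1" if n: "n \<ge> max m (Suc k)" for n
      proof -
        have "e k x \<le> (\<Sum>k<n. e k x)"
          using n e x by (intro member_le_sum) (auto simp: P_def)
        then have "real m * e k x \<le> real n * (\<Sum>k<n. e k x)"
          using n k by (intro mult_mono) auto
        then show ?thesis using m by (simp add: u_def)
      qed
      then have "eventually (\<lambda>n. u n x = indicator U x) sequentially"
        using True by (intro eventually_sequentiallyI[of "max m (Suc k)"]) simp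
      then show ?thesis by (rule tendsto_eventually)
    next
      case False
      then have "u n x = 0" for n using e x by (simp add: u_def P_def)
      then show ?thesis using False by simp
    qed
  next
    show "u n x = 0" if "x \<in> topspace X - U" for n x
      using e that by (simp add: u_def P_def)
  qed (use s0 in \<open>auto simp: u_def\<close>)
qed

lemma integrable_C_b:
  assumes "f \<in> C_b X" and "finite_measure M" and "sets M = sets (borel_of X)"
  shows "integrable M f"
proof -
  obtain B where "\<And>x. x \<in> topspace X \<Longrightarrow> \<bar>f x\<bar> \<le> B"
    using C_b_bounded[OF assms(1)] by metis
  moreover have "space M = topspace X"
    using sets_eq_imp_space_eq[OF assms(3)] by simp
  moreover have "f \<in> borel_measurable M"
    using C_b_measurable[OF assms(1)] assms(3) measurable_cong_sets by blast
  ultimately show ?thesis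
    by (intro finite_measure.integrable_const_bound[OF assms(2), of _ B]) auto
qed

lemma measure_eqI_C_0:
  assumes X: "lc_polish_space X"
    and M: "finite_measure M" "sets M = sets (borel_of X)"
    and N: "finite_measure N" "sets N = sets (borel_of X)"
    and eq: "\<And>f. f \<in> C_0 X \<Longrightarrow> (\<integral>x. f x \<partial>M) = (\<integral>x. f x \<partial>N)"
  shows "M = N"
proof (rule measure_eqI_generator_eq[where E = "{U. openin X U}" and \<Omega> = "topspace X"
      and A = "\<lambda>_. topspace X"])
  fix U assume "U \<in> {U. openin X U}"
  then have U: "openin X U" by simp
  obtain u where u: "\<And>n. u n \<in> C_0 X"
    "\<And>n x. x \<in> topspace X \<Longrightarrow> 0 \<le> u n x" "\<And>n x. x \<in> topspace X \<Longrightarrow> u n x \<le> (1::real)"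
    "\<And>x. x \<in> topspace X \<Longrightarrow> (\<lambda>n. u n x) \<longlonglongrightarrow> indicator U x"
    by (rule C_0_exhausts_open[OF X U]) blast
  have lim: "(\<lambda>n. \<integral>x. u n x \<partial>Q) \<longlonglongrightarrow> measure Q U"
    if Q: "finite_measure Q" "sets Q = sets (borel_of X)" for Q
  proof -
    have [measurable_cong]: "sets Q = sets (borel_of X)" by (rule Q)
    have [measurable]: "u n \<in> borel_measurable (borel_of X)" for n using u(1) by (rule C_0_measurable)
    have [measurable]: "U \<in> sets (borel_of X)" using U by (rule openin_in_sets_borel_of)
    have sp: "space Q = topspace X" using sets_eq_imp_space_eq[OF Q(2)] by simp
    have "(\<lambda>n. \<integral>x. u n x \<partial>Q) \<longlonglongrightarrow> (\<integral>x. indicator U x \<partial>Q)"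
    proof (rule integral_dominated_convergence[where w = "\<lambda>_. 1"])
      show "integrable Q (\<lambda>_. 1 :: real)"
        using finite_measure.integrable_const[OF Q(1)] .
    qed (use u(2-4) in \<open>auto simp: sp\<close>)
    moreover have "U \<inter> space Q = U" using U sp openin_subset by blast
    ultimately show ?thesis by simp
  qed
  have "measure M U = measure N U"
    using lim[OF M] lim[OF N] eq[OF u(1)] by (simp add: LIMSEQ_unique)
  then show "emeasure M U = emeasure N U"
    using M(1) N(1) by (simp add: finite_measure.emeasure_eq_measure)
next
  show "Int_stable {U. openin X U}" by (auto simp: Int_stable_def)
  show "{U. openin X U} \<subseteq> Pow (topspace X)" using openin_subset by blast
  show "emeasure M (topspace X) \<noteq> \<infinity>"
    using M(1) by (simp add: finite_measure.emeasure_finite)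
qed (use M N in \<open>auto simp: sets_borel_of\<close>)

section \<open>Ternary coding of points by a countable base\<close>

text \<open>
  The point of the Cantor set whose ternary digits are $2$ where \<open>c\<close> holds and $0$ elsewhere; avoiding
  the digit $1$ lets nearby points share their leading digits.
\<close>

definition ternary :: "(nat \<Rightarrow> bool) \<Rightarrow> real" where
  "ternary c = (\<Sum>i. of_bool (c i) * (2/3) * (1/3) ^ i)"

lemma summable_ternary: "summable (\<lambda>i. of_bool (c i) * (2/3) * (1/3 :: real) ^ i)"
proof (rule summable_comparison_test)
  show "\<exists>N. \<forall>n\<ge>N. norm (of_bool (c n) * (2/3) * (1/3 :: real) ^ n) \<le> (1/3) ^ n"
    by (auto simp: of_bool_def)
qed (simp add: summable_geometric)

lemma ternary_nonneg: "0 \<le> ternary c"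
  unfolding ternary_def by (intro suminf_nonneg summable_ternary) simp

lemma ternary_le_1: "ternary c \<le> 1"
proof -
  have "ternary c \<le> (\<Sum>i. (2/3) * (1/3 :: real) ^ i)"
    unfolding ternary_def
    by (intro suminf_le summable_ternary summable_mult summable_geometric) (auto simp: of_bool_def)
  also have "\<dots> = 1"
    by (subst suminf_mult) (auto simp: suminf_geometric summable_geometric)
  finally show ?thesis .
qed

lemma ternary_rec: "ternary c = of_bool (c 0) * (2/3) + ternary (\<lambda>i. c (Suc i)) / 3"
proof -
  have "ternary c = of_bool (c 0) * (2/3) + (\<Sum>i. of_bool (c (Suc i)) * (2/3) * (1/3) ^ Suc i)"
    using suminf_split_head[OF summable_ternary[of c]] by (simp add: ternary_def)
  also have "(\<Sum>i. of_bool (c (Suc i)) * (2/3) * (1/3 :: real) ^ Suc i)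
      = (\<Sum>i. (1/3) * (of_bool (c (Suc i)) * (2/3) * (1/3) ^ i))"
    by (simp add: mult_ac)
  also have "\<dots> = ternary (\<lambda>i. c (Suc i)) / 3"
    by (subst suminf_mult[OF summable_ternary[of "\<lambda>i. c (Suc i)"]]) (simp add: ternary_def)
  finally show ?thesis .
qed

lemma ternary_close_imp_prefix_eq:
  "\<bar>ternary c - ternary c'\<bar> < (1/3) ^ n \<Longrightarrow> i < n \<Longrightarrow> c i = c' i"
proof (induction n arbitrary: c c' i)
  case (Suc n)
  let ?d = "\<lambda>i. c (Suc i)" and ?d' = "\<lambda>i. c' (Suc i)"
  have lt: "\<bar>ternary c - ternary c'\<bar> < 1/3"
  proof -
    have "(1/3 :: real) ^ Suc n \<le> 1/3" by (simp add: power_le_one)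
    then show ?thesis using Suc.prems(1) by linarith
  qed
  have c0: "c 0 = c' 0"
    using lt ternary_rec[of c] ternary_rec[of c'] ternary_nonneg[of ?d] ternary_nonneg[of ?d']
      ternary_le_1[of ?d] ternary_le_1[of ?d']
    by (cases "c 0"; cases "c' 0") auto
  then have "\<bar>ternary ?d - ternary ?d'\<bar> < (1/3) ^ n"
    using Suc.prems(1) ternary_rec[of c] ternary_rec[of c'] by (auto simp: abs_if split: if_splits)
  then have "c (Suc j) = c' (Suc j)" if "j < n" for j using Suc.IH that by blast
  then show ?case using c0 Suc.prems(2) by (cases i) auto
qed simp

text \<open>
  The code of a point records its membership in each of the sets \<open>V i\<close>.
\<close>

definition base_code :: "(nat \<Rightarrow> 'a set) \<Rightarrow> 'a \<Rightarrow> real" where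
  "base_code V x = ternary (\<lambda>i. x \<in> V i)"

lemma base_code_measurable:
  assumes "\<And>i. V i \<in> sets M"
  shows "base_code V \<in> borel_measurable M"
proof -
  have [measurable]: "V i \<in> sets M" for i by (rule assms)
  have "base_code V = (\<lambda>x. \<Sum>i. indicator (V i) x * (2/3) * (1/3) ^ i)"
    by (auto simp: base_code_def ternary_def indicator_def of_bool_def fun_eq_iff)
  then show ?thesis by simp
qed

lemma base_code_in_unit: "base_code V x \<in> {0..1}"
  by (simp add: base_code_def ternary_nonneg ternary_le_1)

text \<open>
  \<open>V\<close> enumerates a base of the topology of \<open>X\<close>, possibly with repetitions; empty sets are permitted, so
  that the empty space needs no special treatment.
\<close>

definition topology_base :: "'a topology \<Rightarrow> (nat \<Rightarrow> 'a set) \<Rightarrow> bool" where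
  "topology_base X V \<longleftrightarrow>
     (\<forall>i. openin X (V i)) \<and> (\<forall>U x. openin X U \<longrightarrow> x \<in> U \<longrightarrow> (\<exists>i. x \<in> V i \<and> V i \<subseteq> U))"

lemma second_countable_imp_topology_base:
  assumes "second_countable X"
  obtains V where "topology_base X V"
proof -
  obtain \<B> where \<B>: "countable \<B>" "\<And>V. V \<in> \<B> \<Longrightarrow> openin X V"
      "\<And>U x. openin X U \<Longrightarrow> x \<in> U \<Longrightarrow> \<exists>V\<in>\<B>. x \<in> V \<and> V \<subseteq> U"
    using assms unfolding second_countable_def by metis
  define V where "V = from_nat_into (insert {} \<B>)"
  have rng: "range V = insert {} \<B>"
    unfolding V_def using \<B>(1) by (simp add: range_from_nat_into)
  have "openin X (V i)" for i
    using \<B>(2) rng by (metis insert_iff openin_empty rangeI)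
  moreover have "\<exists>i. x \<in> V i \<and> V i \<subseteq> U" if "openin X U" "x \<in> U" for U x
    using \<B>(3)[OF that] rng by (metis insertCI rangeE)
  ultimately show ?thesis using that unfolding topology_base_def by blast
qed

text \<open>
  Although the code is not continuous, it refines $C_0$: points with close codes lie in the same ones
  of finitely many base sets, which can be chosen to cover the compact set where \<open>f\<close> is not small and
  such that \<open>f\<close> is nearly constant on each of them. Points in none of them have small values.
\<close>

lemma C_0_uniformly_continuous_base_code:
  assumes V: "topology_base X V" and f: "f \<in> C_0 X" and e: "e > 0"
  obtains d where "d > 0"
    "\<And>x y. x \<in> topspace X \<Longrightarrow> y \<in> topspace X \<Longrightarrow> \<bar>base_code V x - base_code V y\<bar> < d \<Longrightarrow> \<bar>f x - f y\<bar> < e"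
proof -
  obtain K where K: "compactin X K" "\<forall>x\<in>topspace X - K. \<bar>f x\<bar> < e / 2"
    by (rule C_0_small[OF f half_gt_zero[OF e]])
  have KX: "K \<subseteq> topspace X" using K(1) by (rule compactin_subset_topspace)
  have "\<exists>i. x \<in> V i \<and> (\<forall>y\<in>V i. \<bar>f y - f x\<bar> < e / 2)" if x: "x \<in> K" for x
  proof -
    have "openin X {y \<in> topspace X. f y \<in> ball (f x) (e / 2)}"
      using C_0_continuous[OF f] by (rule openin_continuous_map_preimage) auto
    moreover have "x \<in> {y \<in> topspace X. f y \<in> ball (f x) (e / 2)}" using x KX e by auto
    ultimately obtain i where "x \<in> V i" "V i \<subseteq> {y \<in> topspace X. f y \<in> ball (f x) (e / 2)}"
      using V unfolding topology_base_def by meson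
    then show ?thesis by (intro exI[of _ i]) (auto simp: dist_real_def abs_minus_commute)
  qed
  then obtain idx where idx: "\<And>x. x \<in> K \<Longrightarrow> x \<in> V (idx x)"
      "\<And>x y. x \<in> K \<Longrightarrow> y \<in> V (idx x) \<Longrightarrow> \<bar>f y - f x\<bar> < e / 2"
    by metis
  have "\<exists>\<F>. finite \<F> \<and> \<F> \<subseteq> (\<lambda>x. V (idx x)) ` K \<and> K \<subseteq> \<Union>\<F>"
  proof (rule compactinD[OF K(1)])
    show "openin X U" if "U \<in> (\<lambda>x. V (idx x)) ` K" for U
      using that V by (auto simp: topology_base_def)
    show "K \<subseteq> \<Union> ((\<lambda>x. V (idx x)) ` K)" using idx(1) by blast
  qed
  then obtain C where C: "finite C" "C \<subseteq> K" "K \<subseteq> (\<Union>x\<in>C. V (idx x))"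
    by (metis finite_subset_image)
  define n where "n = Suc (Max (insert 0 (idx ` C)))"
  have n: "idx c < n" if "c \<in> C" for c
    using C(1) that by (auto simp: n_def less_Suc_eq_le intro!: Max_ge)
  show ?thesis
  proof (rule that[of "(1/3) ^ n"])
    fix x y assume x: "x \<in> topspace X" and y: "y \<in> topspace X"
      and d: "\<bar>base_code V x - base_code V y\<bar> < (1/3) ^ n"
    have same: "x \<in> V i \<longleftrightarrow> y \<in> V i" if "i < n" for i
      using ternary_close_imp_prefix_eq[OF d[unfolded base_code_def] that] .
    show "\<bar>f x - f y\<bar> < e"
    proof (cases "\<exists>c\<in>C. x \<in> V (idx c)")
      case True
      then obtain c where c: "c \<in> C" "x \<in> V (idx c)" by blast
      then have "y \<in> V (idx c)" using same n by blast
      then have "\<bar>f x - f c\<bar> < e / 2" "\<bar>f y - f c\<bar> < e / 2" using c idx(2) C(2) by auto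
      then show ?thesis by linarith
    next
      case False
      then have "x \<notin> K" "y \<notin> K" using C(3) same n by blast+
      then have "\<bar>f x\<bar> < e / 2" "\<bar>f y\<bar> < e / 2" using K(2) x y by auto
      then show ?thesis by linarith
    qed
  qed simp
qed

lemma C_0_factors_through_base_code:
  assumes V: "topology_base X V" and f: "f \<in> C_0 X"
  obtains F B where "continuous_on UNIV (F :: real \<Rightarrow> real)" "\<And>y. \<bar>F y\<bar> \<le> B"
    "\<And>x. x \<in> topspace X \<Longrightarrow> F (base_code V x) = f x"
proof -
  let ?S = "base_code V ` topspace X"
  define g where "g y = f (SOME x. x \<in> topspace X \<and> base_code V x = y)" for y
  \<comment> \<open>Points with equal codes have equal values, so the choice made by \<open>SOME\<close> is irrelevant.\<close>
  have gcode: "g (base_code V x) = f x" if x: "x \<in> topspace X" for x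
  proof (rule ccontr)
    assume ne: "g (base_code V x) \<noteq> f x"
    define x' where "x' = (SOME x'. x' \<in> topspace X \<and> base_code V x' = base_code V x)"
    have x': "x' \<in> topspace X" "base_code V x' = base_code V x"
      using someI[of "\<lambda>x'. x' \<in> topspace X \<and> base_code V x' = base_code V x" x] x by (auto simp: x'_def)
    have "0 < \<bar>f x' - f x\<bar>" using ne by (simp add: g_def x'_def)
    then obtain d where "d > 0" "\<And>u v. u \<in> topspace X \<Longrightarrow> v \<in> topspace X
        \<Longrightarrow> \<bar>base_code V u - base_code V v\<bar> < d \<Longrightarrow> \<bar>f u - f v\<bar> < \<bar>f x' - f x\<bar>"
      by (rule C_0_uniformly_continuous_base_code[OF V f]) blast
    from this(2)[OF x'(1) x] this(1) x'(2) show False by simp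
  qed
  have "uniformly_continuous_on ?S g"
    unfolding uniformly_continuous_on_def
  proof (intro allI impI)
    fix e :: real assume "e > 0"
    then obtain d where d: "d > 0" "\<And>x y. x \<in> topspace X \<Longrightarrow> y \<in> topspace X
        \<Longrightarrow> \<bar>base_code V x - base_code V y\<bar> < d \<Longrightarrow> \<bar>f x - f y\<bar> < e"
      by (rule C_0_uniformly_continuous_base_code[OF V f]) blast
    then show "\<exists>d>0. \<forall>x\<in>?S. \<forall>x'\<in>?S. dist x' x < d \<longrightarrow> dist (g x') (g x) < e"
      by (intro exI[of _ d]) (simp add: gcode dist_real_def)
  qed
  then obtain h where h: "uniformly_continuous_on (closure ?S) h" "\<And>y. y \<in> ?S \<Longrightarrow> g y = h y"
    by (rule uniformly_continuous_on_extension_on_closure) blast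
  \<comment> \<open>Compactness of the closure bounds \<open>h\<close>, so that its extension to the line can be kept bounded.\<close>
  have "closure ?S \<subseteq> {0..1}"
    using base_code_in_unit by (intro closure_minimal image_subsetI) simp_all
  then have "compact (closure ?S)"
    by (meson bounded_closed_interval bounded_subset closed_closure compact_eq_bounded_closed)
  then have "compact (h ` closure ?S)"
    using h(1) by (intro compact_continuous_image uniformly_continuous_imp_continuous)
  then have "bounded (h ` closure ?S)" by (rule compact_imp_bounded)
  then obtain B where B: "B > 0" "\<And>y. y \<in> closure ?S \<Longrightarrow> \<bar>h y\<bar> \<le> B"
    unfolding bounded_pos by auto
  obtain F where F: "continuous_on UNIV F" "\<And>y. y \<in> closure ?S \<Longrightarrow> F y = h y"
      "\<And>y. norm (F y) \<le> B"
    using Tietze[of "closure ?S" h UNIV B] uniformly_continuous_imp_continuous[OF h(1)] B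
    by (auto simp: less_imp_le)
  show ?thesis
  proof (rule that[of F B])
    show "F (base_code V x) = f x" if "x \<in> topspace X" for x
    proof -
      have S: "base_code V x \<in> ?S" using that by blast
      then have "F (base_code V x) = h (base_code V x)" by (rule F(2)[OF subsetD[OF closure_subset]])
      also have "\<dots> = f x" using h(2)[OF S] gcode[OF that] by simp
      finally show ?thesis .
    qed
  qed (use F in auto)
qed

section \<open>Vague sequential compactness\<close>

text \<open>
  A limit of codes of points $x_n$ represents either a point of the space or the point at infinity. If
  some \<open>h\<close> in $C_0$ does not vanish there, then the $x_n$ eventually stay in a compact set, and any
  accumulation point of them is the point represented.
\<close>

lemma decode_dichotomy:
  assumes X: "metrizable_space X"
    and F: "\<And>f. f \<in> C_0 X \<Longrightarrow> continuous_on UNIV (F f :: real \<Rightarrow> real)"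
      "\<And>f x. f \<in> C_0 X \<Longrightarrow> x \<in> topspace X \<Longrightarrow> F f (c x) = f x"
    and y: "y \<in> closure (c ` topspace X)"
  shows "(\<exists>x\<in>topspace X. \<forall>f\<in>C_0 X. F f y = f x) \<or> (\<forall>f\<in>C_0 X. F f y = 0)"
proof (rule disjCI)
  assume "\<not> (\<forall>f\<in>C_0 X. F f y = 0)"
  then obtain h where h: "h \<in> C_0 X" "F h y \<noteq> 0" by blast
  obtain s where s: "\<And>n. s n \<in> c ` topspace X" "s \<longlonglongrightarrow> y"
    using y unfolding closure_sequential by blast
  then have "\<exists>x. x \<in> topspace X \<and> s n = c x" for n by blast
  then obtain x where x: "\<And>n. x n \<in> topspace X" "\<And>n. s n = c (x n)" by metis
  have lim: "(\<lambda>n. f (x n)) \<longlonglongrightarrow> F f y" if f: "f \<in> C_0 X" for f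
  proof -
    have "isCont (F f) y" using F(1)[OF f] by (simp add: continuous_on_eq_continuous_at)
    then have "(\<lambda>n. F f (s n)) \<longlonglongrightarrow> F f y" using s(2) by (rule isCont_tendsto_compose)
    then show ?thesis by (simp add: x F(2)[OF f])
  qed
  define e where "e = \<bar>F h y\<bar> / 2"
  have e: "0 < e" "e < \<bar>F h y\<bar>" using h(2) by (auto simp: e_def)
  obtain K where K: "compactin X K" "\<forall>x\<in>topspace X - K. \<bar>h x\<bar> < e"
    by (rule C_0_small[OF h(1) e(1)])
  have "eventually (\<lambda>n. e < \<bar>h (x n)\<bar>) sequentially"
    using tendsto_rabs[OF lim[OF h(1)]] e(2) by (rule order_tendstoD)
  then obtain N where N: "\<And>n. n \<ge> N \<Longrightarrow> e < \<bar>h (x n)\<bar>"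
    unfolding eventually_sequentially by blast
  have xK: "x (n + N) \<in> K" for n
    using N[of "n + N"] K(2) x(1)[of "n + N"] by (smt (verit) Diff_iff le_add2)
  obtain M d where Md: "Metric_space M d" and Xd: "X = Metric_space.mtopology M d"
    using X by (auto simp: metrizable_space_def)
  interpret Metric_space M d by (rule Md)
  have "range (\<lambda>n. x (n + N)) \<subseteq> K" using xK by blast
  then obtain l r where l: "l \<in> K" "strict_mono r" "limitin X ((\<lambda>n. x (n + N)) \<circ> r) l sequentially"
    using K(1) unfolding Xd compactin_sequentially by metis
  have "F f y = f l" if f: "f \<in> C_0 X" for f
  proof -
    have "(\<lambda>n. f (x (r n + N))) \<longlonglongrightarrow> f l"
      using continuous_map_limit[OF C_0_continuous[OF f] l(3)] by (simp add: o_def)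
    moreover have "strict_mono (\<lambda>n. r n + N)" using l(2) by (simp add: strict_mono_def)
    then have "(\<lambda>n. f (x (r n + N))) \<longlonglongrightarrow> F f y"
      using LIMSEQ_subseq_LIMSEQ[OF lim[OF f]] by (auto simp: o_def)
    ultimately show ?thesis using LIMSEQ_unique by blast
  qed
  moreover have "l \<in> topspace X" using l(1) K(1) compactin_subset_topspace by blast
  ultimately show "\<exists>x\<in>topspace X. \<forall>f\<in>C_0 X. F f y = f x" by blast
qed

lemma weak_conv_m_closed_support:
  assumes \<mu>: "\<And>n. real_distribution (\<mu> n)" and \<rho>: "real_distribution \<rho>"
    and conv: "weak_conv_m \<mu> \<rho>" and C: "closed C" and supp: "\<And>n. AE y in \<mu> n. y \<in> C"
  shows "AE y in \<rho>. y \<in> C"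
proof -
  interpret \<rho>: real_distribution \<rho> by (rule \<rho>)
  interpret \<mu>: real_distribution "\<mu> n" for n by (rule \<mu>)
  have ne: "C \<noteq> {}" using supp[of 0] \<mu>.not_empty by (auto simp: \<mu>.AE_False)
  define G :: "real \<Rightarrow> real" where "G y = min 1 (infdist y C)" for y
  have Gc: "continuous_on UNIV G" unfolding G_def by (intro continuous_intros)
  have Gb: "norm (G y) \<le> 1" for y by (simp add: G_def infdist_nonneg)
  have "(\<lambda>n. \<integral>y. G y \<partial>\<mu> n) \<longlonglongrightarrow> (\<integral>y. G y \<partial>\<rho>)"
    using Gc Gb by (intro weak_conv_imp_integral_bdd_continuous_conv[OF \<mu> \<rho> conv])
      (simp_all add: continuous_on_eq_continuous_at)
  moreover have "(\<integral>y. G y \<partial>\<mu> n) = 0" for n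
    using supp[of n] by (intro integral_eq_zero_AE) (auto simp: G_def)
  ultimately have "(\<integral>y. G y \<partial>\<rho>) = 0" by (simp add: LIMSEQ_const_iff)
  moreover have "integrable \<rho> G"
    using Gb borel_measurable_continuous_onI[OF Gc]
    by (intro \<rho>.integrable_const_bound[of _ 1]) auto
  ultimately have "AE y in \<rho>. G y = 0"
    by (subst (asm) integral_nonneg_eq_0_iff_AE) (auto simp: G_def infdist_nonneg)
  then show ?thesis
  proof eventually_elim
    case (elim y)
    then have "infdist y C = 0" by (auto simp: G_def min_def split: if_splits)
    then show ?case using in_closure_iff_infdist_zero[OF ne] C by simp
  qed
qed

text \<open>
  The limit need not be a probability measure, since mass can escape to infinity.
\<close>

theorem vague_sequential_compactness:
  assumes X: "lc_polish_space X" and m: "\<And>n. m n \<in> prob_measures X"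
  obtains r :: "nat \<Rightarrow> nat" and M where "strict_mono r" "subprob_space M"
    "sets M = sets (borel_of X)"
    "\<And>f. f \<in> C_0 X \<Longrightarrow> (\<lambda>n. \<integral>x. f x \<partial>m (r n)) \<longlonglongrightarrow> (\<integral>x. f x \<partial>M)"
proof -
  have prob: "prob_space (m n)" and [measurable_cong]: "sets (m n) = sets (borel_of X)" for n
    using m by (auto simp: prob_measures_def)
  have sp: "space (m n) = topspace X" for n
    using sets_eq_imp_space_eq[of "m n" "borel_of X"] m by (simp add: prob_measures_def)
  have ne: "topspace X \<noteq> {}" using prob_space.not_empty[OF prob] sp by metis
  obtain V where V: "topology_base X V"
    using second_countable_imp_topology_base[OF lc_polish_space_imp_second_countable[OF X]] .
  have [measurable]: "base_code V \<in> borel_measurable (borel_of X)"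
    using V by (intro base_code_measurable openin_in_sets_borel_of) (auto simp: topology_base_def)
  have "\<forall>f\<in>C_0 X. \<exists>F B. continuous_on UNIV (F :: real \<Rightarrow> real) \<and> (\<forall>y. \<bar>F y\<bar> \<le> B) \<and>
      (\<forall>x\<in>topspace X. F (base_code V x) = f x)"
    using C_0_factors_through_base_code[OF V] by metis
  then obtain F B where Fc: "\<And>f. f \<in> C_0 X \<Longrightarrow> continuous_on UNIV (F f :: real \<Rightarrow> real)"
    and FB: "\<And>f y. f \<in> C_0 X \<Longrightarrow> \<bar>F f y\<bar> \<le> B f"
    and Fcode: "\<And>f x. f \<in> C_0 X \<Longrightarrow> x \<in> topspace X \<Longrightarrow> F f (base_code V x) = f x"
    by metis
  have Fm [measurable]: "F f \<in> borel_measurable borel" if "f \<in> C_0 X" for f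
    using Fc[OF that] by (rule borel_measurable_continuous_onI)
  define C where "C = closure (base_code V ` topspace X)"
  have Ccl: "closed C" by (simp add: C_def)
  have codeC: "base_code V x \<in> C" if "x \<in> topspace X" for x
    unfolding C_def by (rule subsetD[OF closure_subset imageI[OF that]])
  define \<mu> where "\<mu> n = distr (m n) borel (base_code V)" for n
  have \<mu>: "real_distribution (\<mu> n)" for n
    using prob unfolding \<mu>_def real_distribution_def real_distribution_axioms_def
    by (auto intro!: prob_space.prob_space_distr)
  have "tight \<mu>"
    unfolding tight_def
  proof (intro conjI allI impI)
    fix e :: real assume e: "e > 0"
    have "measure (\<mu> n) {-1<..1} = 1" for n
    proof -
      have "-1 < base_code V x \<and> base_code V x \<le> 1" for x
        using base_code_in_unit[of V x] unfolding atLeastAtMost_iff by linarith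
      then have "base_code V -` {-1<..1} \<inter> space (m n) = space (m n)" by auto
      moreover have "measure (\<mu> n) {-1<..1} = measure (m n) (base_code V -` {-1<..1} \<inter> space (m n))"
        unfolding \<mu>_def by (rule measure_distr) simp_all
      ultimately have "measure (\<mu> n) {-1<..1} = measure (m n) (space (m n))" by simp
      then show ?thesis using prob_space.prob_space[OF prob] by simp
    qed
    then show "\<exists>a b. a < b \<and> (\<forall>n. 1 - e < measure (\<mu> n) {a<..b})"
      using e by (intro exI[of _ "-1"] exI[of _ 1]) simp
  qed (rule \<mu>)
  then obtain r \<rho> where r: "strict_mono (r :: nat \<Rightarrow> nat)" and \<rho>: "real_distribution \<rho>"
      and conv: "weak_conv_m (\<mu> \<circ> id \<circ> r) \<rho>"
    using tight_imp_convergent_subsubsequence[of \<mu> id] strict_mono_id by blast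
  interpret \<rho>: real_distribution \<rho> by (rule \<rho>)
  have conv': "weak_conv_m (\<lambda>n. \<mu> (r n)) \<rho>" using conv by (simp add: o_def)
  \<comment> \<open>\<open>\<rho>\<close> can charge points outside the image of the code, but not points outside its closure.\<close>
  have AE_C: "AE y in \<rho>. y \<in> C"
  proof (rule weak_conv_m_closed_support[OF \<mu> \<rho> conv' Ccl])
    fix n
    have "AE x in m (r n). base_code V x \<in> C" using codeC by (intro AE_I2) (simp add: sp)
    then show "AE y in \<mu> (r n). y \<in> C"
      unfolding \<mu>_def using borel_closed[OF Ccl] by (subst AE_distr_iff) simp_all
  qed
  have lim: "(\<lambda>n. \<integral>x. f x \<partial>m (r n)) \<longlonglongrightarrow> (\<integral>y. F f y \<partial>\<rho>)" if f: "f \<in> C_0 X" for f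
  proof -
    have "(\<lambda>n. \<integral>y. F f y \<partial>\<mu> (r n)) \<longlonglongrightarrow> (\<integral>y. F f y \<partial>\<rho>)"
      using Fc[OF f] FB[OF f]
      by (intro weak_conv_imp_integral_bdd_continuous_conv[OF \<mu> \<rho> conv'])
        (simp_all add: continuous_on_eq_continuous_at)
    moreover have "(\<integral>y. F f y \<partial>\<mu> (r n)) = (\<integral>x. f x \<partial>m (r n))" for n
    proof -
      have "(\<integral>y. F f y \<partial>\<mu> (r n)) = (\<integral>x. F f (base_code V x) \<partial>m (r n))"
        unfolding \<mu>_def by (rule integral_distr[OF _ Fm[OF f]]) simp
      also have "\<dots> = (\<integral>x. f x \<partial>m (r n))"
        by (rule Bochner_Integration.integral_cong) (simp_all add: sp Fcode[OF f])
      finally show ?thesis .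
    qed
    ultimately show ?thesis by simp
  qed
  obtain u where u: "\<And>n. u n \<in> C_0 X"
    "\<And>x. x \<in> topspace X \<Longrightarrow> (\<lambda>n. u n x) \<longlonglongrightarrow> (indicator (topspace X) x :: real)"
    by (rule C_0_exhausts_open[OF X openin_topspace]) blast
  \<comment> \<open>\<open>Y\<close> consists of the points of \<open>C\<close> that represent a point of the space rather than infinity, and \<open>g\<close>
      decodes them. The functions \<open>u n\<close> have no common zero in \<open>X\<close>, so they tell the two cases apart,
      and \<open>Y\<close> is a Borel set.\<close>
  define Y where "Y = C \<inter> (\<Union>n. {y. 0 < F (u n) y})"
  have [measurable]: "C \<in> sets borel" using Ccl by (rule borel_closed)
  have Ym [measurable]: "Y \<in> sets borel"
    unfolding Y_def using Fm[OF u(1)] by measurable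
  define g where "g y = (SOME x. x \<in> topspace X \<and> (\<forall>f\<in>C_0 X. F f y = f x))" for y
  have gY: "g y \<in> topspace X" "\<And>f. f \<in> C_0 X \<Longrightarrow> F f y = f (g y)" if y: "y \<in> Y" for y
  proof -
    have yC: "y \<in> closure (base_code V ` topspace X)" and "\<not> (\<forall>f\<in>C_0 X. F f y = 0)"
      using y u(1) by (force simp: Y_def C_def)+
    then have "\<exists>x. x \<in> topspace X \<and> (\<forall>f\<in>C_0 X. F f y = f x)"
      using decode_dichotomy[OF lc_polish_space_imp_metrizable[OF X] Fc Fcode yC] by blast
    then have "g y \<in> topspace X \<and> (\<forall>f\<in>C_0 X. F f y = f (g y))"
      unfolding g_def by (rule someI_ex)
    then show "g y \<in> topspace X" "\<And>f. f \<in> C_0 X \<Longrightarrow> F f y = f (g y)" by blast+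
  qed
  have notY: "F f y = 0" if y: "y \<in> C" "y \<notin> Y" and f: "f \<in> C_0 X" for f y
  proof (rule ccontr)
    assume "F f y \<noteq> 0"
    then obtain x where x: "x \<in> topspace X" "\<forall>f\<in>C_0 X. F f y = f x"
      using decode_dichotomy[OF lc_polish_space_imp_metrizable[OF X] Fc Fcode y(1)[unfolded C_def]] f
      by blast
    have "eventually (\<lambda>n. 0 < u n x) sequentially"
      using u(2)[OF x(1)] x(1) by (intro order_tendstoD(1)) auto
    then obtain n where "0 < u n x" by (auto simp: eventually_sequentially)
    then have "0 < F (u n) y" using x(2) u(1) by simp
    then show False using y by (auto simp: Y_def)
  qed
  define R where "R = restrict_space \<rho> Y"
  have Y\<rho>: "Y \<inter> space \<rho> \<in> sets \<rho>" using Ym by simp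
  have spR: "space R = Y" by (simp add: R_def space_restrict_space)
  \<comment> \<open>For open \<open>U\<close>, exhausted by the functions \<open>w n\<close>, the preimage under \<open>g\<close> is the set where some
      \<open>F (w n)\<close> is positive.\<close>
  have gm: "g \<in> measurable R (borel_of X)"
    unfolding borel_of_def
  proof (rule measurable_measure_of)
    show "{U. openin X U} \<subseteq> Pow (topspace X)" using openin_subset by blast
    show "g \<in> space R \<rightarrow> topspace X" using gY(1) by (simp add: spR)
    fix U assume "U \<in> {U. openin X U}"
    then have U: "openin X U" by simp
    obtain w where w: "\<And>n. w n \<in> C_0 X" "\<And>n x. x \<in> topspace X \<Longrightarrow> 0 \<le> w n x"
        "\<And>x. x \<in> topspace X \<Longrightarrow> (\<lambda>n. w n x) \<longlonglongrightarrow> (indicator U x :: real)"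
        "\<And>n x. x \<in> topspace X - U \<Longrightarrow> w n x = 0"
      by (rule C_0_exhausts_open[OF X U]) blast
    have iff: "x \<in> U \<longleftrightarrow> (\<exists>n. 0 < w n x)" if x: "x \<in> topspace X" for x
    proof
      assume "x \<in> U"
      then have "eventually (\<lambda>n. 0 < w n x) sequentially"
        using w(3)[OF x] by (intro order_tendstoD(1)) auto
      then show "\<exists>n. 0 < w n x" by (auto simp: eventually_sequentially)
    qed (use w(4) x in fastforce)
    have "g -` U \<inter> space R = Y \<inter> (\<Union>n. {y. 0 < F (w n) y})"
      using gY iff w(1) by (auto simp: spR)
    moreover have "Y \<inter> (\<Union>n. {y. 0 < F (w n) y}) \<in> sets borel"
      using Fm[OF w(1)] by measurable
    ultimately show "g -` U \<inter> space R \<in> sets R"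
      using Y\<rho> by (simp add: R_def sets_restrict_space_iff)
  qed
  define M where "M = distr R (borel_of X) g"
  have "subprob_space M"
  proof (rule subprob_spaceI)
    have "g -` space (borel_of X) \<inter> space R = Y" using gY(1) by (auto simp: spR)
    then have "emeasure M (space M) = emeasure R Y"
      using emeasure_distr[OF gm sets.top] by (simp add: M_def)
    also have "\<dots> = emeasure \<rho> Y"
      using Y\<rho> by (simp add: R_def emeasure_restrict_space)
    finally have "emeasure M (space M) = emeasure \<rho> Y" .
    then show "emeasure M (space M) \<le> 1" by (simp add: \<rho>.measure_le_1)
    show "space M \<noteq> {}" using ne by (simp add: M_def)
  qed
  moreover have "(\<integral>x. f x \<partial>M) = (\<integral>y. F f y \<partial>\<rho>)" if f: "f \<in> C_0 X" for f
  proof -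
    have "(\<integral>x. f x \<partial>M) = (\<integral>y. f (g y) \<partial>R)"
      unfolding M_def using gm C_0_measurable[OF f] by (rule integral_distr)
    also have "\<dots> = (\<integral>y. F f y \<partial>R)"
      using gY(2) f by (intro Bochner_Integration.integral_cong) (auto simp: spR)
    also have "\<dots> = (\<integral>y. indicator Y y *\<^sub>R F f y \<partial>\<rho>)"
      unfolding R_def using Y\<rho> by (rule integral_restrict_space)
    also have "\<dots> = (\<integral>y. F f y \<partial>\<rho>)"
    proof (rule integral_cong_AE)
      show "AE y in \<rho>. indicator Y y *\<^sub>R F f y = F f y"
        using AE_C by eventually_elim (use notY f in \<open>auto simp: indicator_def\<close>)
    qed (use Fm[OF f] in measurable)
    finally show ?thesis .
  qed
  ultimately show ?thesis
    using that[of r M] r lim by (simp add: M_def)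
qed

section \<open>Action of Markov kernels on measures\<close>

lemma markov_kernel_measurable:
  assumes "markov_kernel X Y K" and "sets m = sets (borel_of X)"
  shows "K \<in> m \<rightarrow>\<^sub>M subprob_algebra (borel_of Y)"
  using measurable_prob_algebraD[of K "borel_of X" "borel_of Y"] assms measurable_cong_sets
  unfolding markov_kernel_def by blast

lemma integral_bind_markov_kernel:
  assumes K: "markov_kernel X Y K" and m: "subprob_space m" "sets m = sets (borel_of X)"
    and f: "f \<in> C_b Y"
  shows "(\<integral>y. f y \<partial>(m \<bind> K)) = (\<integral>x. kernel_op K f x \<partial>m)"
proof -
  note Km = markov_kernel_measurable[OF K m(2)]
  obtain B where B: "\<And>y. y \<in> topspace Y \<Longrightarrow> \<bar>f y\<bar> \<le> B" using C_b_bounded[OF f] by metis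
  have ae: "AE x in m. emeasure (K x) (space (K x)) \<le> ennreal 1"
    using subprob_space.emeasure_space_le_1[OF subprob_space_kernel[OF Km]] by (intro AE_I2) simp
  then show ?thesis
    unfolding kernel_op_def using B m(1)
    by (intro integral_bind[OF C_b_measurable[OF f] _ Km _ ae]) (auto simp: subprob_space_def)
qed

lemma bind_in_prob_measures:
  assumes "m \<in> prob_measures X" and "markov_kernel X Y K"
  shows "m \<bind> K \<in> prob_measures Y"
proof -
  have m: "m \<in> space (prob_algebra (borel_of X))"
    using assms(1) by (simp add: prob_measures_def space_prob_algebra)
  have K: "K \<in> borel_of X \<rightarrow>\<^sub>M prob_algebra (borel_of Y)"
    using assms(2) by (simp add: markov_kernel_def)
  show ?thesis
    using prob_space_bind'[OF m K] sets_bind'[OF m K] by (simp add: prob_measures_def)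
qed

lemma bind_markov_kernel_assoc:
  assumes "m \<in> prob_measures X" and "markov_kernel X Y K" and "markov_kernel Y Z K'"
  shows "m \<bind> K \<bind> K' = m \<bind> (\<lambda>x. K x \<bind> K')"
proof (rule bind_assoc)
  show "K \<in> m \<rightarrow>\<^sub>M subprob_algebra (borel_of Y)"
    using assms(1) by (intro markov_kernel_measurable[OF assms(2)]) (simp add: prob_measures_def)
  show "K' \<in> borel_of Y \<rightarrow>\<^sub>M subprob_algebra (borel_of Z)"
    by (rule markov_kernel_measurable[OF assms(3) refl])
qed

lemma space_prob_measures: "m \<in> prob_measures X \<Longrightarrow> space m = topspace X"
  using sets_eq_imp_space_eq[of m "borel_of X"] by (simp add: prob_measures_def)

lemma mass_bind_markov_kernel:
  assumes K: "markov_kernel X Y K" and m: "subprob_space m" "sets m = sets (borel_of X)"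
  shows "measure (m \<bind> K) (space (m \<bind> K)) = measure m (space m)"
proof -
  have one: "(\<lambda>_. 1) \<in> C_b Y" by (auto simp: C_b_def bounded_iff)
  have sp: "space m = topspace X" using sets_eq_imp_space_eq[OF m(2)] by simp
  have K1: "kernel_op K (\<lambda>_. 1) x = 1" if "x \<in> topspace X" for x
  proof -
    have "K x \<in> space (prob_algebra (borel_of Y))"
      using K that unfolding markov_kernel_def by (intro measurable_space[of K "borel_of X"]) auto
    then have "prob_space (K x)" by (simp add: space_prob_algebra)
    then show ?thesis by (simp add: kernel_op_def prob_space.prob_space)
  qed
  have "measure (m \<bind> K) (space (m \<bind> K)) = (\<integral>y. 1 \<partial>(m \<bind> K))" by simp
  also have "\<dots> = (\<integral>x. kernel_op K (\<lambda>_. 1) x \<partial>m)"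
    by (rule integral_bind_markov_kernel[OF K m one])
  also have "\<dots> = (\<integral>x. 1 \<partial>m)"
    by (rule Bochner_Integration.integral_cong) (simp_all add: K1 sp)
  finally show ?thesis by simp
qed

section \<open>From vague to weak convergence\<close>

lemma integral_cutoff_error:
  assumes m: "m \<in> prob_measures X" and f: "f \<in> C_b X"
    and B: "\<And>x. x \<in> topspace X \<Longrightarrow> \<bar>f x\<bar> \<le> B"
    and u: "u \<in> C_0 X" "\<And>x. x \<in> topspace X \<Longrightarrow> 0 \<le> u x \<and> u x \<le> 1"
  shows "(\<lambda>x. f x * u x) \<in> C_0 X"
    and "\<bar>(\<integral>x. f x \<partial>m) - (\<integral>x. f x * u x \<partial>m)\<bar> \<le> B * (1 - (\<integral>x. u x \<partial>m))"
proof -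
  show fu: "(\<lambda>x. f x * u x) \<in> C_0 X"
  proof (rule C_0_dominated[OF u(1), where c = B])
    show "continuous_map X euclideanreal (\<lambda>x. f x * u x)"
      using f C_0_continuous[OF u(1)] by (intro continuous_map_real_mult) (auto simp: C_b_def)
    show "\<bar>f x * u x\<bar> \<le> B * \<bar>u x\<bar>" if "x \<in> topspace X" for x
      using B[OF that] by (simp add: abs_mult mult_right_mono)
  qed
  interpret prob_space m using m by (simp add: prob_measures_def)
  have int: "integrable m h" if "h \<in> C_b X" for h
    using that m by (intro integrable_C_b[of h X]) (auto simp: prob_measures_def intro: finite_measure_axioms)
  have i: "integrable m f" "integrable m u" "integrable m (\<lambda>x. f x * u x)"
    using f u(1) fu C_0_subset_C_b by (auto intro!: int)
  have "\<bar>(\<integral>x. f x \<partial>m) - (\<integral>x. f x * u x \<partial>m)\<bar> = \<bar>\<integral>x. f x - f x * u x \<partial>m\<bar>"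
    using i by simp
  also have "\<dots> \<le> (\<integral>x. \<bar>f x - f x * u x\<bar> \<partial>m)" by (rule integral_abs_bound)
  also have "\<dots> \<le> (\<integral>x. B * (1 - u x) \<partial>m)"
  proof (rule integral_mono)
    fix x assume "x \<in> space m"
    then have x: "x \<in> topspace X" using space_prob_measures[OF m] by simp
    have "\<bar>f x - f x * u x\<bar> = \<bar>f x\<bar> * (1 - u x)"
      using u(2)[OF x] by (simp add: abs_mult flip: right_diff_distrib[of "f x" 1 "u x", simplified])
    also have "\<dots> \<le> B * (1 - u x)" using B[OF x] u(2)[OF x] by (intro mult_right_mono) auto
    finally show "\<bar>f x - f x * u x\<bar> \<le> B * (1 - u x)" .
  qed (use i in auto)
  also have "\<dots> = B * (1 - (\<integral>x. u x \<partial>m))" using i by (simp add: prob_space)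
  finally show "\<bar>(\<integral>x. f x \<partial>m) - (\<integral>x. f x * u x \<partial>m)\<bar> \<le> B * (1 - (\<integral>x. u x \<partial>m))" .
qed

text \<open>
  If the vague limit is again a probability measure, no mass escapes: a $C_0$ cutoff \<open>u k\<close> that captures
  nearly all of the mass of the limit does so for \<open>m n\<close> with large \<open>n\<close> as well.
\<close>

lemma vague_convergence_imp_weak:
  assumes X: "lc_polish_space X"
    and m: "\<And>n. m n \<in> prob_measures X" and M: "M \<in> prob_measures X"
    and lim: "\<And>f. f \<in> C_0 X \<Longrightarrow> (\<lambda>n. \<integral>x. f x \<partial>m n) \<longlonglongrightarrow> (\<integral>x. f x \<partial>M)"
    and f: "f \<in> C_b X"
  shows "(\<lambda>n. \<integral>x. f x \<partial>m n) \<longlonglongrightarrow> (\<integral>x. f x \<partial>M)"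
proof (rule LIMSEQ_I)
  fix e :: real assume e: "e > 0"
  obtain B where B: "B > 0" "\<And>x. x \<in> topspace X \<Longrightarrow> \<bar>f x\<bar> \<le> B"
    using C_b_bounded[OF f] by metis
  obtain u where u: "\<And>n. u n \<in> C_0 X"
    "\<And>n x. x \<in> topspace X \<Longrightarrow> 0 \<le> u n x" "\<And>n x. x \<in> topspace X \<Longrightarrow> u n x \<le> (1::real)"
    "\<And>x. x \<in> topspace X \<Longrightarrow> (\<lambda>n. u n x) \<longlonglongrightarrow> indicator (topspace X) x"
    by (rule C_0_exhausts_open[OF X openin_topspace]) blast
  interpret M: prob_space M using M by (simp add: prob_measures_def)
  have "(\<lambda>k. \<integral>x. u k x \<partial>M) \<longlonglongrightarrow> (\<integral>x. 1 \<partial>M)"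
  proof (rule integral_dominated_convergence[where w = "\<lambda>_. 1"])
    show "u k \<in> borel_measurable M" for k
      using C_0_measurable[OF u(1)] M measurable_cong_sets unfolding prob_measures_def by blast
  qed (use u(2-4) in \<open>auto simp: space_prob_measures[OF M]\<close>)
  then have "(\<lambda>k. \<integral>x. u k x \<partial>M) \<longlonglongrightarrow> 1" by (simp add: M.prob_space)
  moreover have d: "1 - e / (4 * B) < 1" using e B(1) by simp
  ultimately have "eventually (\<lambda>k. 1 - e / (4 * B) < (\<integral>x. u k x \<partial>M)) sequentially"
    by (rule order_tendstoD)
  then obtain k where k: "1 - e / (4 * B) < (\<integral>x. u k x \<partial>M)"
    by (auto simp: eventually_sequentially)
  have uk: "\<And>x. x \<in> topspace X \<Longrightarrow> 0 \<le> u k x \<and> u k x \<le> 1" using u(2,3) by blast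
  note cut = integral_cutoff_error[OF _ f B(2) u(1) uk]
  have small: "B * (1 - I) < e / 4" if "1 - e / (4 * B) < I" for I
  proof -
    have "B * (1 - I) < B * (e / (4 * B))" using that B(1) by (intro mult_strict_left_mono) auto
    then show ?thesis using B(1) by simp
  qed
  have "eventually (\<lambda>n. 1 - e / (4 * B) < (\<integral>x. u k x \<partial>m n)) sequentially"
    using lim[OF u(1)] k by (rule order_tendstoD)
  moreover have "eventually (\<lambda>n. \<bar>(\<integral>x. f x * u k x \<partial>m n) - (\<integral>x. f x * u k x \<partial>M)\<bar> < e / 4) sequentially"
    using tendstoD[OF lim[OF cut(1)[OF M]], of "e / 4"] e by (simp add: dist_real_def)
  \<comment> \<open>One quarter of \<open>e\<close> for each of the two cutoff errors and for the convergence of the cut off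
      integrals.\<close>
  ultimately have "eventually (\<lambda>n. \<bar>(\<integral>x. f x \<partial>m n) - (\<integral>x. f x \<partial>M)\<bar> < e) sequentially"
  proof eventually_elim
    case (elim n)
    show ?case
      using cut(2)[OF M] cut(2)[OF m[of n]] small[OF k] small[OF elim(1)] elim(2) e by linarith
  qed
  then show "\<exists>n0. \<forall>n\<ge>n0. norm ((\<integral>x. f x \<partial>m n) - (\<integral>x. f x \<partial>M)) < e"
    by (simp add: eventually_sequentially)
qed

text \<open>
  A countable family of Feller kernels that jointly separates probability measures also detects weak
  convergence to a probability measure, from the $C_0$ functions on the target spaces alone.
\<close>

theorem weak_convergence_from_kernel_images:
  assumes X: "lc_polish_space X" and E: "\<And>N. lc_polish_space (E N)"
    and \<Lambda>: "\<And>N :: nat. feller_kernel X (E N) (\<Lambda> N)"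
    and inj: "inj_on (\<lambda>m N. m \<bind> \<Lambda> N) (prob_measures X)"
    and m: "\<And>n. m n \<in> prob_measures X" and \<mu>: "\<mu> \<in> prob_measures X"
    and lim: "\<And>N g. g \<in> C_0 (E N) \<Longrightarrow>
      (\<lambda>n. \<integral>y. g y \<partial>(m n \<bind> \<Lambda> N)) \<longlonglongrightarrow> (\<integral>y. g y \<partial>(\<mu> \<bind> \<Lambda> N))"
    and f: "f \<in> C_b X"
  shows "(\<lambda>n. \<integral>x. f x \<partial>m n) \<longlonglongrightarrow> (\<integral>x. f x \<partial>\<mu>)"
proof (rule ccontr)
  assume "\<not> ?thesis"
  then obtain e where e: "e > 0"
      "\<And>n0. \<exists>n\<ge>n0. e \<le> dist (\<integral>x. f x \<partial>m n) (\<integral>x. f x \<partial>\<mu>)"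
    unfolding lim_sequentially by (metis not_le)
  then have "infinite {n. e \<le> dist (\<integral>x. f x \<partial>m n) (\<integral>x. f x \<partial>\<mu>)}"
    by (auto simp: infinite_nat_iff_unbounded_le)
  then obtain s :: "nat \<Rightarrow> nat" where s: "strict_mono s"
      "\<And>n. e \<le> dist (\<integral>x. f x \<partial>m (s n)) (\<integral>x. f x \<partial>\<mu>)"
    using infinite_enumerate by blast
  \<comment> \<open>A vague limit of a further subsequence of those \<open>m n\<close> that stay away from the limit.\<close>
  obtain r :: "nat \<Rightarrow> nat" and M where r: "strict_mono r" and M: "subprob_space M" "sets M = sets (borel_of X)"
    and vague: "\<And>f. f \<in> C_0 X \<Longrightarrow> (\<lambda>n. \<integral>x. f x \<partial>m (s (r n))) \<longlonglongrightarrow> (\<integral>x. f x \<partial>M)"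
    using vague_sequential_compactness[OF X, of "\<lambda>n. m (s n)"] m by metis
  have sr: "strict_mono (s \<circ> r)" using s(1) r by (rule strict_mono_o)
  have K: "markov_kernel X (E N) (\<Lambda> N)" for N using \<Lambda> by (simp add: feller_kernel_def)
  have M\<Lambda>: "M \<bind> \<Lambda> N = \<mu> \<bind> \<Lambda> N" for N
  proof (rule measure_eqI_C_0[OF E[of N]])
    have "subprob_space (M \<bind> \<Lambda> N)"
      by (rule subprob_space_bind[OF M(1) markov_kernel_measurable[OF K M(2)]])
    then show "finite_measure (M \<bind> \<Lambda> N)" by (simp add: subprob_space_def)
    show "sets (M \<bind> \<Lambda> N) = sets (borel_of (E N))"
      by (rule sets_bind_measurable[OF markov_kernel_measurable[OF K M(2)]
            subprob_space.subprob_not_empty[OF M(1)]])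
    have "\<mu> \<bind> \<Lambda> N \<in> prob_measures (E N)" by (rule bind_in_prob_measures[OF \<mu> K])
    then show "finite_measure (\<mu> \<bind> \<Lambda> N)" "sets (\<mu> \<bind> \<Lambda> N) = sets (borel_of (E N))"
      by (simp_all add: prob_measures_def prob_space_def)
    fix g assume g: "g \<in> C_0 (E N)"
    then have gb: "g \<in> C_b (E N)" using C_0_subset_C_b by blast
    have "(\<lambda>n. \<integral>x. kernel_op (\<Lambda> N) g x \<partial>m (s (r n))) \<longlonglongrightarrow> (\<integral>x. kernel_op (\<Lambda> N) g x \<partial>M)"
      using \<Lambda>[of N] g by (intro vague) (simp add: feller_kernel_def)
    moreover have "(\<integral>x. kernel_op (\<Lambda> N) g x \<partial>m n) = (\<integral>y. g y \<partial>(m n \<bind> \<Lambda> N))" for n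
      using m[of n] unfolding prob_measures_def
      by (intro integral_bind_markov_kernel[OF K _ _ gb, symmetric]) (auto intro: prob_space_imp_subprob_space)
    ultimately have "(\<lambda>n. \<integral>y. g y \<partial>(m (s (r n)) \<bind> \<Lambda> N)) \<longlonglongrightarrow> (\<integral>y. g y \<partial>(M \<bind> \<Lambda> N))"
      by (simp add: integral_bind_markov_kernel[OF K M gb])
    moreover have "(\<lambda>n. \<integral>y. g y \<partial>(m (s (r n)) \<bind> \<Lambda> N)) \<longlonglongrightarrow> (\<integral>y. g y \<partial>(\<mu> \<bind> \<Lambda> N))"
      using LIMSEQ_subseq_LIMSEQ[OF lim[OF g] sr] by (simp add: o_def)
    ultimately show "(\<integral>y. g y \<partial>(M \<bind> \<Lambda> N)) = (\<integral>y. g y \<partial>(\<mu> \<bind> \<Lambda> N))"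
      by (rule LIMSEQ_unique)
  qed
  \<comment> \<open>Markov kernels preserve mass, so no mass was lost in the vague limit.\<close>
  have "measure M (space M) = measure (\<mu> \<bind> \<Lambda> 0) (space (\<mu> \<bind> \<Lambda> 0))"
    using mass_bind_markov_kernel[OF K M, of 0] by (simp add: M\<Lambda>)
  also have "\<dots> = 1"
    using bind_in_prob_measures[OF \<mu> K[of 0]] by (simp add: prob_measures_def prob_space.prob_space)
  finally have "prob_space M"
    using M(1) finite_measure.emeasure_eq_measure[of M] by (intro prob_spaceI) (simp add: subprob_space_def)
  then have Mp: "M \<in> prob_measures X" using M(2) by (simp add: prob_measures_def)
  have "M = \<mu>" using inj Mp \<mu> M\<Lambda> unfolding inj_on_def by presburger
  then have "(\<lambda>n. \<integral>x. f x \<partial>m (s (r n))) \<longlonglongrightarrow> (\<integral>x. f x \<partial>\<mu>)"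
    using vague_convergence_imp_weak[OF X, of "\<lambda>n. m (s (r n))" M] m Mp vague f by blast
  from tendstoD[OF this e(1)] show False
    using s(2) by (auto simp: eventually_sequentially not_less[symmetric])
qed

section \<open>Convergence to equilibrium on the boundary\<close>

theorem theorem2p10:
  fixes E :: "nat \<Rightarrow> 'a topology"
    and L :: "nat \<Rightarrow> 'a \<Rightarrow> 'a measure"
    and Einf :: "'b topology"
    and Linf :: "nat \<Rightarrow> 'b \<Rightarrow> 'a measure"
    and P :: "nat \<Rightarrow> real \<Rightarrow> 'a \<Rightarrow> 'a measure"
    and Pinf :: "real \<Rightarrow> 'b \<Rightarrow> 'b measure"
    and \<mu> :: "nat \<Rightarrow> 'a measure"
    and \<mu>inf :: "'b measure"
  assumes "feller_system E L"
    and "feller_boundary E L Einf Linf"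
    and "\<And>N. feller_semigroup (E N) (P N)"
    and "\<And>N. intertwined (E (Suc N)) (P (Suc N)) (L N) (P N)"
    and "feller_semigroup Einf Pinf"
    and "\<And>N. intertwined Einf Pinf (Linf N) (P N)"
    and "\<mu> \<in> consistent_sequences E L"
    and "\<mu>inf \<in> prob_measures Einf"
    and "\<And>N. \<mu>inf \<bind> Linf N = \<mu> N"
    and "\<And>\<nu> N f. \<nu> \<in> consistent_sequences E L \<Longrightarrow> f \<in> C_b (E N) \<Longrightarrow>
           ((\<lambda>t. \<integral>x. f x \<partial>(\<nu> N \<bind> P N t)) \<longlongrightarrow> (\<integral>x. f x \<partial>\<mu> N)) at_top"
  shows "(\<forall>\<nu>inf\<in>prob_measures Einf. \<forall>f\<in>C_b Einf.
            ((\<lambda>t. \<integral>x. f x \<partial>(\<nu>inf \<bind> Pinf t)) \<longlongrightarrow> (\<integral>x. f x \<partial>\<mu>inf)) at_top) \<and>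
         (\<forall>\<nu>. invariant_measure Einf Pinf \<nu> \<longleftrightarrow> \<nu> = \<mu>inf)"
proof -
  have E: "lc_polish_space (E N)" and LK: "markov_kernel (E (Suc N)) (E N) (L N)" for N
    using assms(1) by (simp_all add: feller_system_def feller_kernel_def)
  have X: "lc_polish_space Einf" and Linf: "feller_kernel Einf (E N) (Linf N)"
    and Lcons: "x \<in> topspace Einf \<Longrightarrow> Linf (Suc N) x \<bind> L N = Linf N x" for N x
    using assms(2) by (simp_all add: feller_boundary_def)
  have inj: "inj_on (\<lambda>m N. m \<bind> Linf N) (prob_measures Einf)"
    using assms(2) by (simp add: feller_boundary_def borel_isomorphism_def bij_betw_def)
  have LinfK: "markov_kernel Einf (E N) (Linf N)" for N
    using Linf by (simp add: feller_kernel_def)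
  have PK: "markov_kernel (E N) (E N) (P N t)" and PinfF: "feller_kernel Einf Einf (Pinf t)"
    if "t \<ge> 0" for N t
    using that assms(3)[of N] assms(5) by (simp_all add: feller_semigroup_def feller_kernel_def)
  have PinfK: "markov_kernel Einf Einf (Pinf t)" if "t \<ge> 0" for t
    using PinfF[OF that] by (simp add: feller_kernel_def)
  have consistent: "(\<lambda>N. \<nu> \<bind> Linf N) \<in> consistent_sequences E L" if \<nu>: "\<nu> \<in> prob_measures Einf" for \<nu>
    unfolding consistent_sequences_def
  proof (intro CollectI conjI allI)
    fix N
    show "\<nu> \<bind> Linf N \<in> prob_measures (E N)" by (rule bind_in_prob_measures[OF \<nu> LinfK])
    have "\<nu> \<bind> Linf (Suc N) \<bind> L N = \<nu> \<bind> (\<lambda>x. Linf (Suc N) x \<bind> L N)"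
      by (rule bind_markov_kernel_assoc[OF \<nu> LinfK LK])
    also have "\<dots> = \<nu> \<bind> Linf N"
      by (rule bind_cong) (simp_all add: Lcons space_prob_measures[OF \<nu>])
    finally show "\<nu> \<bind> Linf (Suc N) \<bind> L N = \<nu> \<bind> Linf N" .
  qed
  have intertwine: "\<nu> \<bind> Pinf t \<bind> Linf N = \<nu> \<bind> Linf N \<bind> P N t"
    if \<nu>: "\<nu> \<in> prob_measures Einf" and t: "t \<ge> 0" for \<nu> t N
  proof -
    have "\<nu> \<bind> Pinf t \<bind> Linf N = \<nu> \<bind> (\<lambda>x. Pinf t x \<bind> Linf N)"
      by (rule bind_markov_kernel_assoc[OF \<nu> PinfK[OF t] LinfK])
    also have "\<dots> = \<nu> \<bind> (\<lambda>x. Linf N x \<bind> P N t)"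
      using assms(6)[of N] t by (intro bind_cong) (simp_all add: intertwined_def space_prob_measures[OF \<nu>])
    also have "\<dots> = \<nu> \<bind> Linf N \<bind> P N t"
      by (rule bind_markov_kernel_assoc[OF \<nu> LinfK PK[OF t], symmetric])
    finally show ?thesis .
  qed
  have conv: "((\<lambda>t. \<integral>x. f x \<partial>(\<nu> \<bind> Pinf t)) \<longlongrightarrow> (\<integral>x. f x \<partial>\<mu>inf)) at_top"
    if \<nu>: "\<nu> \<in> prob_measures Einf" and f: "f \<in> C_b Einf" for \<nu> f
  proof -
    \<comment> \<open>Nothing is assumed about \<open>Pinf t\<close> for negative \<open>t\<close>.\<close>
    have "((\<lambda>t. \<integral>x. f x \<partial>(\<nu> \<bind> Pinf (max 0 t))) \<longlongrightarrow> (\<integral>x. f x \<partial>\<mu>inf)) at_top"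
    proof (rule tendsto_at_topI_sequentially)
      fix t :: "nat \<Rightarrow> real" assume "filterlim t at_top sequentially"
      then have t: "filterlim (\<lambda>n. max 0 (t n)) at_top sequentially"
        by (rule filterlim_at_top_mono) simp
      show "(\<lambda>n. \<integral>x. f x \<partial>(\<nu> \<bind> Pinf (max 0 (t n)))) \<longlonglongrightarrow> (\<integral>x. f x \<partial>\<mu>inf)"
      proof (rule weak_convergence_from_kernel_images[OF X E Linf inj _ assms(8) _ f])
        show "\<nu> \<bind> Pinf (max 0 (t n)) \<in> prob_measures Einf" for n
          by (rule bind_in_prob_measures[OF \<nu> PinfK]) simp
        fix N g assume "g \<in> C_0 (E N)"
        then have "g \<in> C_b (E N)" using C_0_subset_C_b by blast
        from assms(10)[OF consistent[OF \<nu>] this]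
        have "(\<lambda>n. \<integral>y. g y \<partial>(\<nu> \<bind> Linf N \<bind> P N (max 0 (t n)))) \<longlonglongrightarrow> (\<integral>y. g y \<partial>\<mu> N)"
          using t by (rule filterlim_compose)
        then show "(\<lambda>n. \<integral>y. g y \<partial>(\<nu> \<bind> Pinf (max 0 (t n)) \<bind> Linf N))
            \<longlonglongrightarrow> (\<integral>y. g y \<partial>(\<mu>inf \<bind> Linf N))"
          by (simp add: intertwine[OF \<nu>] assms(9))
      qed
    qed
    moreover have "eventually (\<lambda>t. (\<integral>x. f x \<partial>(\<nu> \<bind> Pinf (max 0 t))) = (\<integral>x. f x \<partial>(\<nu> \<bind> Pinf t))) at_top"
      using eventually_ge_at_top[of 0] by eventually_elim (simp add: max_def)
    ultimately show ?thesis by (rule Lim_transform_eventually)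
  qed
  have eqI: "\<nu> = \<nu>'" if "\<nu> \<in> prob_measures Einf" "\<nu>' \<in> prob_measures Einf"
      "\<And>f. f \<in> C_0 Einf \<Longrightarrow> (\<integral>x. f x \<partial>\<nu>) = (\<integral>x. f x \<partial>\<nu>')" for \<nu> \<nu>'
    using that by (intro measure_eqI_C_0[OF X]) (auto simp: prob_measures_def prob_space_def)
  have step: "(\<integral>x. f x \<partial>(\<nu> \<bind> Pinf t)) = (\<integral>x. kernel_op (Pinf t) f x \<partial>\<nu>)"
    if "\<nu> \<in> prob_measures Einf" "t \<ge> 0" "f \<in> C_0 Einf" for \<nu> t f
    using that C_0_subset_C_b[of Einf]
    by (intro integral_bind_markov_kernel[OF PinfK])
      (auto simp: prob_measures_def intro: prob_space_imp_subprob_space)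
  have "\<mu>inf \<bind> Pinf t = \<mu>inf" if t: "t \<ge> 0" for t
  proof (rule eqI)
    fix f assume f: "f \<in> C_0 Einf"
    define h where "h = kernel_op (Pinf t) f"
    have h: "h \<in> C_0 Einf" using PinfF[OF t] f by (simp add: feller_kernel_def h_def)
    have fb: "f \<in> C_b Einf" and hb: "h \<in> C_b Einf" using f h C_0_subset_C_b by blast+
    have "((\<lambda>s. \<integral>x. f x \<partial>(\<mu>inf \<bind> Pinf (s + t))) \<longlongrightarrow> (\<integral>x. f x \<partial>\<mu>inf)) at_top"
      using conv[OF assms(8) fb]
      by (rule filterlim_compose) (rule filterlim_at_top_mono[OF filterlim_ident], use t in simp)
    moreover have "eventually (\<lambda>s. (\<integral>x. f x \<partial>(\<mu>inf \<bind> Pinf (s + t)))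
        = (\<integral>x. h x \<partial>(\<mu>inf \<bind> Pinf s))) at_top"
      using eventually_ge_at_top[of 0]
    proof eventually_elim
      case (elim s)
      have "(\<integral>x. f x \<partial>(\<mu>inf \<bind> Pinf (s + t))) = (\<integral>x. kernel_op (Pinf (s + t)) f x \<partial>\<mu>inf)"
        using elim t by (intro step assms(8) f) simp
      also have "\<dots> = (\<integral>x. kernel_op (Pinf s) h x \<partial>\<mu>inf)"
        using assms(5) elim t f unfolding feller_semigroup_def h_def
        by (intro Bochner_Integration.integral_cong) (simp_all add: space_prob_measures[OF assms(8)])
      also have "\<dots> = (\<integral>x. h x \<partial>(\<mu>inf \<bind> Pinf s))"
        by (rule step[OF assms(8) elim h, symmetric])
      finally show ?case .
    qed
    ultimately have "((\<lambda>s. \<integral>x. h x \<partial>(\<mu>inf \<bind> Pinf s)) \<longlongrightarrow> (\<integral>x. f x \<partial>\<mu>inf)) at_top"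
      by (rule Lim_transform_eventually)
    then have "(\<integral>x. h x \<partial>\<mu>inf) = (\<integral>x. f x \<partial>\<mu>inf)"
      using conv[OF assms(8) hb] by (intro tendsto_unique[OF trivial_limit_at_top_linorder])
    then show "(\<integral>x. f x \<partial>(\<mu>inf \<bind> Pinf t)) = (\<integral>x. f x \<partial>\<mu>inf)"
      by (simp add: step[OF assms(8) t f] h_def)
  qed (use bind_in_prob_measures[OF assms(8) PinfK[OF t]] assms(8) in auto)
  then have inv: "invariant_measure Einf Pinf \<mu>inf"
    using assms(8) by (simp add: invariant_measure_def)
  have uniq: "\<nu> = \<mu>inf" if \<nu>: "invariant_measure Einf Pinf \<nu>" for \<nu>
  proof (rule eqI)
    show \<nu>p: "\<nu> \<in> prob_measures Einf" using \<nu> by (simp add: invariant_measure_def)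
    fix f assume "f \<in> C_0 Einf"
    then have "f \<in> C_b Einf" using C_0_subset_C_b by blast
    note conv[OF \<nu>p this]
    moreover have "eventually (\<lambda>t. (\<integral>x. f x \<partial>(\<nu> \<bind> Pinf t)) = (\<integral>x. f x \<partial>\<nu>)) at_top"
      using eventually_ge_at_top[of 0]
      by eventually_elim (use \<nu> in \<open>simp add: invariant_measure_def\<close>)
    ultimately have "((\<lambda>_. \<integral>x. f x \<partial>\<nu>) \<longlongrightarrow> (\<integral>x. f x \<partial>\<mu>inf)) (at_top :: real filter)"
      by (rule Lim_transform_eventually)
    then show "(\<integral>x. f x \<partial>\<nu>) = (\<integral>x. f x \<partial>\<mu>inf)"
      by (simp add: tendsto_const_iff)
  qed (rule assms(8))
  show ?thesis using conv inv uniq by blast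
qed

end
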